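(* The code loops $C_1^3,\dots,C_5^3$ have the following basic representations $V_1,\dots,V_5$, respectively: $V_1=\langle\{1,2,3,4\},\{1,2,5,6\},\{1,3,5,7\}\rangle$; $V_2=\langle\{1,\dots,8\},\{1,2,3,4,9,10,11,12\},\{1,5,6,7,9,10,11,13\}\rangle$; $V_3=\langle\{1,\dots,8\},\{1,2,3,4,5,6,9,10\},\{1,2,3,4,5,7,9,11\}\rangle$; $V_4=\langle\{1,2,3,4\},\{1,2,5,6,7,8,9,10,11,12,13,14\},\{1,3,5,6,7,8,9,10,11,15,16,17\}\rangle$; $V_5=\langle\{1,\dots,12\},\{1,\dots,8,13,14,15,16\},\{1,2,3,4,5,9,10,11,13,14,15,17\}\rangle$.
   Context: Vectors of $\mathbf F_2^m$ are identified with subsets of $\{1,\dots,m\}$ (their supports); $\langle\cdot\rangle$ denotes $\mathbf F_2$-span; $V_1,\dots,V_5$ are subspaces of $\mathbf F_2^7,\mathbf F_2^{13},\mathbf F_2^{11},\mathbf F_2^{17},\mathbf F_2^{17}$ respectively. $|v|$ is cardinality. A double even code is a subspace $V\subseteq\mathbf F_2^m$ with $|v|\equiv0\pmod 4$ and $|u\cap v|\equiv 0\pmod 2$ for all $u,v\in V$. There is a function $\phi:V\times V\to\{1,-1\}$ with $\phi(v,v)=(-1)^{|v|/4}$, $\phi(v,w)=(-1)^{|v\cap w|/2}\phi(w,v)$, $\phi(0,v)=\phi(v,0)=1$, $\phi(v+w,u)=\phi(v,w+u)\phi(v,w)\phi(w,u)(-1)^{|v\cap w\cap u|}$. The code loop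 $L(V)$ is the set $\{1,-1\}\times V$ with product $(\epsilon,v)(\delta,w)=(\epsilon\delta\,\phi(v,w),v+w)$; it is a Moufang loop, of rank $\dim_{\mathbf F_2}V$. A code loop is a loop isomorphic to some $L(V)$. Commutators: $[x,y]=x^{-1}y^{-1}xy$; associators: $(x,y,z)=((xy)z)(x(yz))^{-1}$. If $L$ is a nonassociative code loop of rank $3$ with generators $a,b,c$ (elements whose images form a basis of $L/\{\pm1\}$), then $(a,b,c)=-1$, and the characteristic vector with respect to $a,b,c$ is $(\lambda_1,\dots,\lambda_6)\in\mathbf F_2^6$ with $a^2=(-1)^{\lambda_1}$, $b^2=(-1)^{\lambda_2}$, $c^2=(-1)^{\lambda_3}$, $[a,b]=(-1)^{\lambda_4}$, $[a,c]=(-1)^{\lambda_5}$, $[b,c]=(-1)^{\lambda_6}$. $C_1^3,\dots,C_5^3$ are the nonassociative code loops of rank $3$ with characteristic vectors $(111111)$, $(000000)$, $(000111)$, $(110000)$, $(100000)$ respectively. A representation of a code loop $L$ is a double even code $V\subseteq\mathbf F_2^m$ with $L\simeq L(V)$; its degree is $m$. It is basic if its degree is minimal among all representations of $L$. Throughout, only reduced representations are considered: defining $i\sim j$ on $\{1,\dots,m\}$ iff for every $v\in V$ either $\{i,j\}\subseteq v$ or $\{i,j\}\cap v=\emptyset$, every $\sim$-class has fewer than $8$ elements. *)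

theory Defs
  imports
    "HOL-Algebra.Group"
    "HOL-Library.Z2"
    "HOL-Library.Function_Algebras"
    "HOL-Library.Indicator_Function"
begin

text \<open>
  Vectors over the two-element field are functions \<open>nat \<Rightarrow> bit\<close>, and the space of dimension \<open>m\<close> is the set of
  those with support inside \<open>{1..m}\<close>. A vector is identified with its support; conversely a subset
  \<open>S\<close> is the vector \<open>indicator S\<close>. Cardinalities and intersections are those of supports.
\<close>

type_synonym f2vec = "nat \<Rightarrow> bit"

definition f2_scale :: "bit \<Rightarrow> f2vec \<Rightarrow> f2vec" where
  "f2_scale c v = (\<lambda>i. c * v i)"

global_interpretation F2: vector_space f2_scale
  by unfold_locales (auto simp: f2_scale_def fun_eq_iff algebra_simps)

definition supp :: "f2vec \<Rightarrow> nat set" where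
  "supp v = {i. v i = 1}"

definition double_even_code :: "nat \<Rightarrow> f2vec set \<Rightarrow> bool" where
  "double_even_code m V \<longleftrightarrow>
     F2.subspace V \<and> (\<forall>v\<in>V. supp v \<subseteq> {1..m}) \<and>
     (\<forall>v\<in>V. card (supp v) mod 4 = 0) \<and>
     (\<forall>u\<in>V. \<forall>v\<in>V. card (supp u \<inter> supp v) mod 2 = 0)"

text \<open>The divisions below are exact on a double even code.\<close>

definition code_cocycle :: "f2vec set \<Rightarrow> (f2vec \<Rightarrow> f2vec \<Rightarrow> int) \<Rightarrow> bool" where
  "code_cocycle V \<phi> \<longleftrightarrow>
     (\<forall>v\<in>V. \<forall>w\<in>V. \<phi> v w \<in> {1, -1}) \<and>
     (\<forall>v\<in>V. \<phi> v v = (-1) ^ (card (supp v) div 4)) \<and>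
     (\<forall>v\<in>V. \<forall>w\<in>V. \<phi> v w = (-1) ^ (card (supp v \<inter> supp w) div 2) * \<phi> w v) \<and>
     (\<forall>v\<in>V. \<phi> 0 v = 1 \<and> \<phi> v 0 = 1) \<and>
     (\<forall>v\<in>V. \<forall>w\<in>V. \<forall>u\<in>V.
        \<phi> (v + w) u =
          \<phi> v (w + u) * \<phi> v w * \<phi> w u * (-1) ^ card (supp v \<inter> supp w \<inter> supp u))"

text \<open>
  Loops use the record type \<open>monoid\<close> (a carrier with a product and a unit), which does not by itself
  impose associativity.
\<close>

definition is_loop :: "('a, 'b) monoid_scheme \<Rightarrow> bool" where
  "is_loop L \<longleftrightarrow>
     \<one>\<^bsub>L\<^esub> \<in> carrier L \<and>
     (\<forall>x\<in>carrier L. \<forall>y\<in>carrier L. x \<otimes>\<^bsub>L\<^esub> y \<in> carrier L) \<and>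
     (\<forall>x\<in>carrier L. \<one>\<^bsub>L\<^esub> \<otimes>\<^bsub>L\<^esub> x = x \<and> x \<otimes>\<^bsub>L\<^esub> \<one>\<^bsub>L\<^esub> = x) \<and>
     (\<forall>a\<in>carrier L. \<forall>b\<in>carrier L.
        (\<exists>!x. x \<in> carrier L \<and> a \<otimes>\<^bsub>L\<^esub> x = b) \<and>
        (\<exists>!y. y \<in> carrier L \<and> y \<otimes>\<^bsub>L\<^esub> a = b))"

definition nonassociative :: "('a, 'b) monoid_scheme \<Rightarrow> bool" where
  "nonassociative L \<longleftrightarrow>
     (\<exists>x\<in>carrier L. \<exists>y\<in>carrier L. \<exists>z\<in>carrier L.
        (x \<otimes>\<^bsub>L\<^esub> y) \<otimes>\<^bsub>L\<^esub> z \<noteq> x \<otimes>\<^bsub>L\<^esub> (y \<otimes>\<^bsub>L\<^esub> z))"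

text \<open>
  Code loops are Moufang, hence any two elements generate a group and the bracketing of the
  commutator is immaterial.
\<close>

definition loop_commutator :: "('a, 'b) monoid_scheme \<Rightarrow> 'a \<Rightarrow> 'a \<Rightarrow> 'a" where
  "loop_commutator L x y = ((inv\<^bsub>L\<^esub> x \<otimes>\<^bsub>L\<^esub> inv\<^bsub>L\<^esub> y) \<otimes>\<^bsub>L\<^esub> x) \<otimes>\<^bsub>L\<^esub> y"

definition code_loop :: "f2vec set \<Rightarrow> (f2vec \<Rightarrow> f2vec \<Rightarrow> int) \<Rightarrow> (int \<times> f2vec) monoid" where
  "code_loop V \<phi> =
     \<lparr>carrier = {1, -1} \<times> V,
      mult = (\<lambda>(\<epsilon>, v) (\<delta>, w). (\<epsilon> * \<delta> * \<phi> v w, v + w)),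
      one = (1, 0)\<rparr>"

text \<open>
  Up to isomorphism, the loop \<open>code_loop V \<phi>\<close> does not depend on the choice of \<open>\<phi>\<close>; being
  isomorphic to \<open>L(V)\<close> means being isomorphic to it for some admissible \<open>\<phi>\<close>.
\<close>

definition isomorphic_to_code_loop :: "('a, 'b) monoid_scheme \<Rightarrow> f2vec set \<Rightarrow> bool" where
  "isomorphic_to_code_loop L V \<longleftrightarrow> (\<exists>\<phi>. code_cocycle V \<phi> \<and> L \<cong> code_loop V \<phi>)"

definition is_code_loop_of_rank :: "nat \<Rightarrow> ('a, 'b) monoid_scheme \<Rightarrow> bool" where
  "is_code_loop_of_rank n L \<longleftrightarrow>
     is_loop L \<and>
     (\<exists>m V. double_even_code m V \<and> F2.dim V = n \<and> isomorphic_to_code_loop L V)"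

text \<open>
  Given an isomorphism \<open>h\<close> from \<open>L\<close> onto \<open>L(V)\<close>, the element \<open>-1\<close> of \<open>L\<close> is the one that \<open>h\<close> maps
  to \<open>(-1, 0)\<close>, and \<open>snd \<circ> h\<close> induces the identification of \<open>L/{\<plusminus>1}\<close> with \<open>V\<close>. In the
  nonassociative case neither \<open>-1\<close> nor the notion of generators depends on \<open>h\<close>, because \<open>-1\<close> is
  the only associator different from \<open>1\<close>.
\<close>

definition characteristic_vector ::
    "('a, 'b) monoid_scheme \<Rightarrow> 'a \<Rightarrow> 'a \<Rightarrow> 'a \<Rightarrow> bit list \<Rightarrow> bool" where
  "characteristic_vector L a b c ls \<longleftrightarrow>
     a \<in> carrier L \<and> b \<in> carrier L \<and> c \<in> carrier L \<and>
     (\<exists>m V \<phi> h z.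
        double_even_code m V \<and> code_cocycle V \<phi> \<and> h \<in> iso L (code_loop V \<phi>) \<and>
        distinct [snd (h a), snd (h b), snd (h c)] \<and>
        F2.independent {snd (h a), snd (h b), snd (h c)} \<and>
        F2.span {snd (h a), snd (h b), snd (h c)} = V \<and>
        z \<in> carrier L \<and> h z = (-1, 0) \<and>
        [a \<otimes>\<^bsub>L\<^esub> a, b \<otimes>\<^bsub>L\<^esub> b, c \<otimes>\<^bsub>L\<^esub> c,
         loop_commutator L a b, loop_commutator L a c, loop_commutator L b c]
          = map (\<lambda>l. if l = 1 then z else \<one>\<^bsub>L\<^esub>) ls)"

definition rank3_loop_with_vector :: "bit list \<Rightarrow> ('a, 'b) monoid_scheme \<Rightarrow> bool" where
  "rank3_loop_with_vector ls L \<longleftrightarrow>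
     is_code_loop_of_rank 3 L \<and> nonassociative L \<and>
     (\<exists>a b c. characteristic_vector L a b c ls)"

text \<open>
  \<open>is_C1 L\<close>, \dots, \<open>is_C5 L\<close> say that \<open>L\<close> is (a copy of) the respective nonassociative code loop of
  rank 3.
\<close>

definition is_C1 :: "('a, 'b) monoid_scheme \<Rightarrow> bool" where
  "is_C1 = rank3_loop_with_vector [1, 1, 1, 1, 1, 1]"

definition is_C2 :: "('a, 'b) monoid_scheme \<Rightarrow> bool" where
  "is_C2 = rank3_loop_with_vector [0, 0, 0, 0, 0, 0]"

definition is_C3 :: "('a, 'b) monoid_scheme \<Rightarrow> bool" where
  "is_C3 = rank3_loop_with_vector [0, 0, 0, 1, 1, 1]"

definition is_C4 :: "('a, 'b) monoid_scheme \<Rightarrow> bool" where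
  "is_C4 = rank3_loop_with_vector [1, 1, 0, 0, 0, 0]"

definition is_C5 :: "('a, 'b) monoid_scheme \<Rightarrow> bool" where
  "is_C5 = rank3_loop_with_vector [1, 0, 0, 0, 0, 0]"

definition coord_equiv :: "nat \<Rightarrow> f2vec set \<Rightarrow> (nat \<times> nat) set" where
  "coord_equiv m V =
     {(i, j). i \<in> {1..m} \<and> j \<in> {1..m} \<and>
        (\<forall>v\<in>V. {i, j} \<subseteq> supp v \<or> {i, j} \<inter> supp v = {})}"

definition reduced :: "nat \<Rightarrow> f2vec set \<Rightarrow> bool" where
  "reduced m V \<longleftrightarrow> (\<forall>C \<in> {1..m} // coord_equiv m V. card C < 8)"

text \<open>Representations are reduced by convention, also where minimality of the degree is concerned.\<close>

definition is_representation :: "nat \<Rightarrow> f2vec set \<Rightarrow> ('a, 'b) monoid_scheme \<Rightarrow> bool" where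
  "is_representation m V L \<longleftrightarrow>
     double_even_code m V \<and> reduced m V \<and> isomorphic_to_code_loop L V"

definition basic_representation :: "nat \<Rightarrow> f2vec set \<Rightarrow> ('a, 'b) monoid_scheme \<Rightarrow> bool" where
  "basic_representation m V L \<longleftrightarrow>
     is_representation m V L \<and> (\<forall>m' V'. is_representation m' V' L \<longrightarrow> m \<le> m')"

definition spanned_by :: "nat set list \<Rightarrow> f2vec set" where
  "spanned_by Ss = F2.span (indicator ` set Ss)"

definition V1 :: "f2vec set" where
  "V1 = spanned_by [{1,2,3,4}, {1,2,5,6}, {1,3,5,7}]"

definition V2 :: "f2vec set" where
  "V2 = spanned_by [{1..8}, {1,2,3,4,9,10,11,12}, {1,5,6,7,9,10,11,13}]"

definition V3 :: "f2vec set" where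
  "V3 = spanned_by [{1..8}, {1,2,3,4,5,6,9,10}, {1,2,3,4,5,7,9,11}]"

definition V4 :: "f2vec set" where
  "V4 = spanned_by
     [{1,2,3,4}, {1,2,5,6,7,8,9,10,11,12,13,14}, {1,3,5,6,7,8,9,10,11,15,16,17}]"

definition V5 :: "f2vec set" where
  "V5 = spanned_by
     [{1..12}, {1,2,3,4,5,6,7,8,13,14,15,16}, {1,2,3,4,5,9,10,11,13,14,15,17}]"

end

theory Submission
  imports Defs
begin

text \<open>
  On a doubly even code with basis \<open>a, b, c\<close>, the function \<open>|v| / 4\<close> modulo 2 is a cubic polynomial in the
  coordinates, whose coefficients are the characteristic vector (squares and commutators) and
  \<open>|a \<inter> b \<inter> c|\<close> modulo 2 (the associator). Weights modulo 8 thus determine the code loop, and conversely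
  an isomorphism of nonassociative code loops fixes \<open>-1\<close>, since it is the nontrivial associator, and so
  induces a linear map of the codes that preserves weights modulo 8. Hence a code represents the loop with
  a given characteristic vector iff it has a basis whose weights modulo 8 are given by the cubic form.
  A cocycle for the form is the one of the octonions (as a twisted group algebra of \<open>F\<^sub>2\<^sup>3\<close>) with an
  additional bilinear term.

  For minimality, split the coordinates into the regions of the Venn diagram of \<open>a, b, c\<close>. The
  congruences modulo 8 make the sizes of the seven inner regions odd, and small lengths are then excluded
  by linear arithmetic.
\<close>

text \<open>Everything rests on |v + w| + 2 |v \<inter> w| = |v| + |w|. Each use trades a weight
  modulo 2k for an intersection modulo k, so weights modulo 8 fix pairwise intersections modulo 4
  and triple ones modulo 2, which is all that a cocycle sees. The obstacle to minimality is that a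
  competing representation is an arbitrary code with an abstract loop isomorphism and no basis
  adapted to the characteristic vector. The induced additive map supplies one, so the lower bound
  becomes a statement about three vectors with prescribed weights modulo 8. Nonassociativity enters
  as the coefficient 1 of xyz. It makes the values of the form sum to 1, and this single fact yields
  both the independence of the three vectors and the oddness of the regions. Seven odd regions
  occupy 7 + 2s coordinates; the lengths 7, 11, 13, 17 are the cases s = 0, 2, 3, 5.\<close>

section \<open>Weights and the cubic form of a basis\<close>

\<comment> \<open>These simp rules turn the field operations into bit operations.\<close>
declare add_bit_eq_xor [simp del] mult_bit_eq_and [simp del]

definition wt :: "f2vec \<Rightarrow> nat" where
  "wt v = card (supp v)"

lemma supp_zero [simp]: "supp 0 = {}"
  by (simp add: supp_def)

lemma supp_times: "supp (v * w) = supp v \<inter> supp w"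
  by (auto simp: supp_def mult_bit_eq_and)

lemma bit_add_eq_1_iff: "(x::bit) + y = 1 \<longleftrightarrow> x \<noteq> y"
  by (cases x; cases y) auto

lemma bit_add_self [simp]: "(x::bit) + x = 0"
  by (cases x) auto

lemma bit_add_left_self [simp]: "(x::bit) + (x + y) = y"
  by (cases x; cases y) auto

lemma bit_times_self [simp]: "(x::bit) * x = x"
  by (cases x) auto

lemma supp_add: "supp (v + w) = (supp v - supp w) \<union> (supp w - supp v)"
  by (auto simp: supp_def bit_add_eq_1_iff)

lemma f2vec_add_self [simp]: "(v::f2vec) + v = 0"
  by (simp add: fun_eq_iff)

lemma f2vec_times_self [simp]: "(v::f2vec) * v = v"
  by (simp add: fun_eq_iff)

lemma f2vec_add_left_self [simp]: "(v::f2vec) + (v + w) = w"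
  by (simp add: fun_eq_iff)

lemma f2vec_minus [simp]: "(v::f2vec) - w = v + w"
  by (simp add: fun_eq_iff)

lemma f2vec_add_eq_iff: "(v::f2vec) + w = u \<longleftrightarrow> v = u + w"
  using eq_diff_eq[of v u w] by auto

lemma wt_zero [simp]: "wt 0 = 0"
  by (simp add: wt_def)

lemma wt_add:
  assumes "finite (supp v)" "finite (supp w)"
  shows "wt (v + w) + 2 * wt (v * w) = wt v + wt w"
proof -
  have "card (supp (v + w)) = card (supp v - supp w) + card (supp w - supp v)"
    unfolding supp_add by (rule card_Un_disjoint) (use assms in auto)
  moreover have "card (supp v) = card (supp v - supp w) + card (supp v \<inter> supp w)"
    using card_Int_Diff[OF assms(1), of "supp w"] by simp
  moreover have "card (supp w) = card (supp w - supp v) + card (supp v \<inter> supp w)"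
    using card_Int_Diff[OF assms(2), of "supp v"] by (simp add: Int_commute)
  ultimately show ?thesis
    by (simp add: wt_def supp_times)
qed

text \<open>This is \<open>wt_add\<close> for the traces of \<open>u\<close> and \<open>v\<close> on
  \<open>w\<close>, which intersect in \<open>u * v * w\<close>. It polarizes intersections as
  \<open>wt_add\<close> polarizes weights.\<close>

lemma wt_add_times:
  assumes "finite (supp u)" "finite (supp v)"
  shows "wt ((u + v) * w) + 2 * wt (u * v * w) = wt (u * w) + wt (v * w)"
proof -
  have "u * w * (v * w) = u * v * w"
    using f2vec_times_self[of w] by (metis mult.assoc mult.commute)
  then show ?thesis
    using wt_add[of "u * w" "v * w"] assms by (simp add: supp_times distrib_right)
qed

section \<open>Coordinates with respect to three vectors, and the cubic form\<close>

definition comb :: "f2vec \<Rightarrow> f2vec \<Rightarrow> f2vec \<Rightarrow> bit \<Rightarrow> bit \<Rightarrow> bit \<Rightarrow> f2vec" where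
  "comb a b c x y z = f2_scale x a + f2_scale y b + f2_scale z c"

lemma f2_scale_simps [simp]: "f2_scale 0 v = 0" "f2_scale 1 v = v"
  by (simp_all add: f2_scale_def fun_eq_iff)

lemma comb_add:
  "comb a b c x y z + comb a b c x' y' z' = comb a b c (x + x') (y + y') (z + z')"
  by (simp only: comb_def F2.scale_left_distrib ac_simps)

lemma span_triple: "F2.span {a, b, c} = {v. \<exists>x y z. v = comb a b c x y z}"
proof -
  have "v + f2_scale x a + f2_scale y b + f2_scale z c = 0 \<longleftrightarrow> v = comb a b c x y z" for v x y z
    by (simp only: f2vec_add_eq_iff comb_def ac_simps add_0_left)
  then show ?thesis
    by (auto simp: F2.span_insert F2.span_breakdown_eq F2.span_singleton)
qed

text \<open>The entries of \<open>ls\<close> are the coefficients of the squares and commutators.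
  The coefficient of \<open>x * y * z\<close> is fixed to 1 because the associator of the generators
  is -1.\<close>

definition cubic :: "bit list \<Rightarrow> bit \<Rightarrow> bit \<Rightarrow> bit \<Rightarrow> bit" where
  "cubic ls x y z = ls!0 * x + ls!1 * y + ls!2 * z + ls!3 * x * y + ls!4 * x * z + ls!5 * y * z
     + x * y * z"

text \<open>Independence is a consequence (\<open>frame_independent\<close>). Finiteness is part of
  the notion because \<open>card\<close> is 0 on infinite sets, where \<open>wt_add\<close> breaks
  down.\<close>

definition frame :: "f2vec \<Rightarrow> f2vec \<Rightarrow> f2vec \<Rightarrow> bit list \<Rightarrow> bool" where
  "frame a b c ls \<longleftrightarrow>
     finite (supp a) \<and> finite (supp b) \<and> finite (supp c) \<and>
     (\<forall>x y z. wt (comb a b c x y z) mod 8 = 4 * of_bit (cubic ls x y z))"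

lemma all_bit: "(\<forall>x::bit. P x) \<longleftrightarrow> P 0 \<and> P 1"
  by (metis bit.exhaust)

text \<open>Here \<open>p\<close> stands for |v + w| and \<open>r\<close> for |v \<inter> w|. Modulo
  8 we have p = 4x + 4y - 2r, so r modulo 4 and p modulo 8 determine each other. The equivalence
  serves both to build frames from intersection counts and to recover intersections from
  weights.\<close>

lemma polarize_mod_8:
  assumes eq: "p + 2 * r = m + (n::nat)" and m: "m mod 8 = 4 * of_bit x" and n: "n mod 8 = 4 * of_bit y"
  shows "p mod 8 = 4 * of_bit (x + y + z) \<longleftrightarrow> r mod 4 = 2 * of_bit z"
proof -
  have "(p mod 8 + 2 * (r mod 4)) mod 8 = (p + 2 * r) mod 8"
    by (simp add: mult_mod_right mod_add_eq)
  also have "\<dots> = (4 * of_bit x + 4 * of_bit y) mod 8"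
    unfolding eq m[symmetric] n[symmetric] by (simp add: mod_add_eq)
  finally have sum: "(P + 2 * R) mod 8 = (4 * of_bit x + 4 * of_bit y) mod 8"
    if "P = p mod 8" "R = r mod 4" for P R
    using that by simp
  have "P = 4 * of_bit (x + y + z) \<longleftrightarrow> R = 2 * of_bit z" if "P = p mod 8" "R = r mod 4" for P R
  proof -
    \<comment> \<open>Only the residues matter, so finitely many cases remain.\<close>
    have "R < 4" "P < 8"
      using that by auto
    then have "R \<in> {0, 1, 2, 3}" "P \<in> {0, 1, 2, 3, 4, 5, 6, 7}"
      by auto
    then show ?thesis
      using sum[OF that] by (cases x; cases y; cases z) (auto dest: dvd_imp_le)
  qed
  then show ?thesis by blast
qed

lemma polarize_mod_4:
  assumes "p + 2 * r = m + (n::nat)" "m mod 4 = 2 * of_bit x" "n mod 4 = 2 * of_bit y"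
  shows "p mod 4 = 2 * of_bit (x + y + z) \<longleftrightarrow> r mod 2 = of_bit z"
proof -
  \<comment> \<open>Doubling the whole equation reduces the claim to
    \<open>polarize_mod_8\<close>.\<close>
  have "2 * p + 2 * (2 * r) = 2 * m + 2 * n" "2 * m mod 8 = 4 * of_bit x" "2 * n mod 8 = 4 * of_bit y"
    using assms mult_mod_right[of 2 m 4] mult_mod_right[of 2 n 4] by simp_all
  then have "2 * p mod 8 = 4 * of_bit (x + y + z) \<longleftrightarrow> 2 * r mod 4 = 2 * of_bit z"
    by (rule polarize_mod_8)
  moreover have "2 * p mod 8 = 2 * (p mod 4)" "2 * r mod 4 = 2 * (r mod 2)"
    by (simp_all add: mult_mod_right)
  ultimately show ?thesis
    by linarith
qed

text \<open>Polarizing once at \<open>a + b\<close>, \<open>a + c\<close>, \<open>b + c\<close>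
  trades their weights for pairwise intersections; polarizing twice at \<open>a + b + c\<close>
  reaches the triple intersection. This is the bridge between frames and the loop data: squares,
  commutators, associator.\<close>

lemma frame_iff:
  assumes fin: "finite (supp a)" "finite (supp b)" "finite (supp c)"
  shows "frame a b c ls \<longleftrightarrow>
    wt a mod 8 = 4 * of_bit (ls!0) \<and> wt b mod 8 = 4 * of_bit (ls!1) \<and>
    wt c mod 8 = 4 * of_bit (ls!2) \<and> wt (a * b) mod 4 = 2 * of_bit (ls!3) \<and>
    wt (a * c) mod 4 = 2 * of_bit (ls!4) \<and> wt (b * c) mod 4 = 2 * of_bit (ls!5) \<and>
    odd (wt (a * b * c))" (is "_ \<longleftrightarrow> ?R")
proof -
  have ab: "wt (a + b) mod 8 = 4 * of_bit (ls!0 + ls!1 + ls!3) \<longleftrightarrow> wt (a * b) mod 4 = 2 * of_bit (ls!3)"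
    if "wt a mod 8 = 4 * of_bit (ls!0)" "wt b mod 8 = 4 * of_bit (ls!1)"
    by (rule polarize_mod_8[OF wt_add]) (rule fin that)+
  have ac: "wt (a + c) mod 8 = 4 * of_bit (ls!0 + ls!2 + ls!4) \<longleftrightarrow> wt (a * c) mod 4 = 2 * of_bit (ls!4)"
    if "wt a mod 8 = 4 * of_bit (ls!0)" "wt c mod 8 = 4 * of_bit (ls!2)"
    by (rule polarize_mod_8[OF wt_add]) (rule fin that)+
  have bc: "wt (b + c) mod 8 = 4 * of_bit (ls!1 + ls!2 + ls!5) \<longleftrightarrow> wt (b * c) mod 4 = 2 * of_bit (ls!5)"
    if "wt b mod 8 = 4 * of_bit (ls!1)" "wt c mod 8 = 4 * of_bit (ls!2)"
    by (rule polarize_mod_8[OF wt_add]) (rule fin that)+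
  have abc': "wt ((a + b) * c) mod 4 = 2 * of_bit (ls!4 + ls!5 + 1) \<longleftrightarrow> wt (a * b * c) mod 2 = of_bit 1"
    if "wt (a * c) mod 4 = 2 * of_bit (ls!4)" "wt (b * c) mod 4 = 2 * of_bit (ls!5)"
    by (rule polarize_mod_4[OF wt_add_times]) (rule fin that)+
  \<comment> \<open>The value of the form at (1,1,1) is grouped as the value for
    \<open>a + b\<close>, the value for \<open>c\<close>, and the polar term of the two, which
    \<open>abc'\<close> resolves further.\<close>
  have abc: "wt (a + b + c) mod 8 = 4 * of_bit ((ls!0 + ls!1 + ls!3) + ls!2 + (ls!4 + ls!5 + 1))
      \<longleftrightarrow> wt ((a + b) * c) mod 4 = 2 * of_bit (ls!4 + ls!5 + 1)"
    if "wt (a + b) mod 8 = 4 * of_bit (ls!0 + ls!1 + ls!3)" "wt c mod 8 = 4 * of_bit (ls!2)"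
    by (rule polarize_mod_8[OF wt_add]) (use fin in \<open>simp add: supp_add\<close>, (rule fin that)+)
  have "frame a b c ls \<longleftrightarrow>
    wt a mod 8 = 4 * of_bit (ls!0) \<and> wt b mod 8 = 4 * of_bit (ls!1) \<and>
    wt c mod 8 = 4 * of_bit (ls!2) \<and> wt (a + b) mod 8 = 4 * of_bit (ls!0 + ls!1 + ls!3) \<and>
    wt (a + c) mod 8 = 4 * of_bit (ls!0 + ls!2 + ls!4) \<and>
    wt (b + c) mod 8 = 4 * of_bit (ls!1 + ls!2 + ls!5) \<and>
    wt (a + b + c) mod 8 = 4 * of_bit ((ls!0 + ls!1 + ls!3) + ls!2 + (ls!4 + ls!5 + 1))"
  proof -
    have "ls!0 + ls!1 + ls!2 + ls!3 + ls!4 + ls!5 + 1 = (ls!0 + ls!1 + ls!3) + ls!2 + (ls!4 + ls!5 + 1)"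
      by (simp only: ac_simps)
    then show ?thesis
      using fin by (simp only: frame_def all_bit comb_def cubic_def f2_scale_simps mult_zero_left
        mult_zero_right mult_1_right add_0_left add_0_right wt_zero simp_thms
        mod_0 mult_0_right even_zero not_True_eq_False of_bool_eq) blast
  qed
  also have "\<dots> \<longleftrightarrow> ?R"
  proof -
    have "wt (a * b * c) mod 2 = of_bit 1 \<longleftrightarrow> odd (wt (a * b * c))"
      by (simp add: odd_iff_mod_2_eq_one)
    then show ?thesis
      using ab ac bc abc abc' by blast
  qed
  finally show ?thesis .
qed

lemma supp_f2_scale: "supp (f2_scale x v) \<subseteq> supp v"
  by (cases x) auto

lemma supp_comb: "supp (comb a b c x y z) \<subseteq> supp a \<union> supp b \<union> supp c"
  unfolding comb_def supp_add using supp_f2_scale by blast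

lemma finite_supp_comb:
  "frame a b c ls \<Longrightarrow> finite (supp (comb a b c x y z))"
  using supp_comb[of a b c x y z] by (auto simp: frame_def intro: finite_subset)

lemma frame_wt: "frame a b c ls \<Longrightarrow> wt (comb a b c x y z) mod 8 = 4 * of_bit (cubic ls x y z)"
  by (simp add: frame_def)

lemma comb_in_span [simp]: "comb a b c x y z \<in> F2.span {a, b, c}"
  by (auto simp: span_triple)

text \<open>Summing a polynomial over all of F_2^3 extracts the coefficient of xyz: a monomial
  missing a variable takes the value 1 an even number of times.\<close>

lemma sum_cubic:
  "cubic ls 0 0 0 + cubic ls 0 0 1 + cubic ls 0 1 0 + cubic ls 0 1 1 +
   cubic ls 1 0 0 + cubic ls 1 0 1 + cubic ls 1 1 0 + cubic ls 1 1 1 = 1"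
  by (simp add: cubic_def ac_simps)

text \<open>
  If the combination vanished for a nonzero coefficient vector, the weights, and hence the cubic
  form, would be invariant under a nonzero translation; but the values of the form sum up to 1.
\<close>

lemma frame_comb_eq_0:
  assumes "frame a b c ls" "comb a b c x y z = 0"
  shows "x = 0 \<and> y = 0 \<and> z = 0"
proof -
  have inv: "cubic ls (p + x) (q + y) (r + z) = cubic ls p q r" for p q r
  proof -
    have "comb a b c (p + x) (q + y) (r + z) = comb a b c p q r"
      using assms(2) by (simp flip: comb_add)
    then have "4 * (of_bit (cubic ls (p + x) (q + y) (r + z)) :: nat) = 4 * of_bit (cubic ls p q r)"
      using frame_wt[OF assms(1)] by metis
    then show ?thesis
      by (cases "cubic ls (p + x) (q + y) (r + z)"; cases "cubic ls p q r") auto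
  qed
  show ?thesis
    using sum_cubic[of ls] inv[of 0 0 0] inv[of 0 0 1] inv[of 0 1 0] inv[of 0 1 1]
      inv[of 1 0 0] inv[of 1 0 1] inv[of 1 1 0] inv[of 1 1 1]
    by (cases x; cases y; cases z) (simp_all add: ac_simps)
qed

lemma frame_comb_inject:
  assumes "frame a b c ls"
  shows "comb a b c x y z = comb a b c x' y' z' \<longleftrightarrow> x = x' \<and> y = y' \<and> z = z'"
proof
  assume "comb a b c x y z = comb a b c x' y' z'"
  then have "comb a b c (x + x') (y + y') (z + z') = 0"
    by (simp flip: comb_add)
  then have "x + x' = 0" "y + y' = 0" "z + z' = 0"
    using frame_comb_eq_0[OF assms] by blast+
  then show "x = x' \<and> y = y' \<and> z = z'"
    by (cases x; cases x'; cases y; cases y'; cases z; cases z') auto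
qed simp

lemma comb_simps [simp]:
  "comb a b c 0 0 0 = 0" "comb a b c 1 0 0 = a" "comb a b c 0 1 0 = b" "comb a b c 0 0 1 = c"
  by (simp_all add: comb_def)

lemma frame_independent:
  assumes "frame a b c ls"
  shows "distinct [a, b, c]" "F2.independent {a, b, c}"
proof -
  note inj = frame_comb_inject[OF assms]
  have "a \<noteq> b" "a \<noteq> c" "b \<noteq> c" "c \<noteq> 0"
    using inj[of 1 0 0 0 1 0] inj[of 1 0 0 0 0 1] inj[of 0 1 0 0 0 1] inj[of 0 0 1 0 0 0] by auto
  moreover have "a \<notin> F2.span {b, c}"
  proof
    assume "a \<in> F2.span {b, c}"
    \<comment> \<open>Padding with the zero vector lets \<open>span_triple\<close> describe the span
      of two vectors; below, the same is done for one vector.\<close>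
    then obtain x y z where "a = comb 0 b c x y z"
      using F2.span_mono[of "{b, c}" "{0, b, c}"] by (auto simp: span_triple)
    then have "comb a b c 1 0 0 = comb a b c 0 y z"
      by (simp add: comb_def)
    then show False
      unfolding inj by simp
  qed
  moreover have "b \<notin> F2.span {c}"
  proof
    assume "b \<in> F2.span {c}"
    then obtain x y z where "b = comb 0 0 c x y z"
      using F2.span_mono[of "{c}" "{0, 0, c}"] by (auto simp: span_triple simp del: insert_absorb2)
    then have "comb a b c 0 1 0 = comb a b c 0 0 z"
      by (simp add: comb_def)
    then show False
      unfolding inj by simp
  qed
  ultimately show "distinct [a, b, c]" "F2.independent {a, b, c}"
    by (auto simp: F2.independent_insert F2.independent_empty)
qed

section \<open>Double even codes and frames\<close>

lemma double_even_codeD: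
  assumes "double_even_code m V" "v \<in> V"
  shows "supp v \<subseteq> {1..m}" "finite (supp v)" "wt v mod 4 = 0"
  using assms finite_subset by (fastforce simp: double_even_code_def wt_def)+

lemma double_even_code_subspace: "double_even_code m V \<Longrightarrow> F2.subspace V"
  by (simp add: double_even_code_def)

text \<open>Closure under addition makes 2 |u \<inter> v| = |u| + |v| - |u + v| divisible by 4, so
  the condition on intersections follows from the one on weights.\<close>

lemma double_even_codeI:
  assumes "F2.subspace V" and supp: "\<And>v. v \<in> V \<Longrightarrow> supp v \<subseteq> {1..m}" and wt: "\<And>v. v \<in> V \<Longrightarrow> wt v mod 4 = 0"
  shows "double_even_code m V"
proof -
  have "card (supp u \<inter> supp v) mod 2 = 0" if "u \<in> V" "v \<in> V" for u v
  proof -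
    have aux: "r mod 2 = 0" if "p + 2 * r = m + n" "p mod 4 = 0" "m mod 4 = 0" "n mod 4 = 0"
      for p r m n :: nat
      using that by presburger
    have "wt (u * v) mod 2 = 0"
    proof (rule aux[OF wt_add])
      show "wt (u + v) mod 4 = 0"
        using assms(1) that by (intro wt F2.subspace_add)
    qed (use that supp wt finite_subset in \<open>blast+\<close>)
    then show ?thesis
      by (simp add: wt_def supp_times)
  qed
  then show ?thesis
    using assms by (auto simp: double_even_code_def wt_def)
qed

lemma frame_double_even_code:
  assumes "frame a b c ls" "supp a \<subseteq> {1..m}" "supp b \<subseteq> {1..m}" "supp c \<subseteq> {1..m}"
  shows "double_even_code m (F2.span {a, b, c})"
proof (rule double_even_codeI)
  fix v assume "v \<in> F2.span {a, b, c}"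
  then obtain x y z where v: "v = comb a b c x y z"
    by (auto simp: span_triple)
  show "supp v \<subseteq> {1..m}"
    using supp_comb[of a b c x y z] assms v by blast
  have "wt v mod 8 mod 4 = 0"
    by (simp add: v frame_wt[OF assms(1)])
  then show "wt v mod 4 = 0"
    by (simp add: mod_mod_cancel)
qed simp

section \<open>Signs, and the cocycle of the cubic form\<close>

definition bit_sign :: "bit \<Rightarrow> int" where
  "bit_sign x = (-1) ^ of_bit x"

lemma bit_sign_simps [simp]: "bit_sign 0 = 1" "bit_sign 1 = -1"
  by (simp_all add: bit_sign_def)

lemma bit_sign_add: "bit_sign (x + y) = bit_sign x * bit_sign y"
  by (cases x; cases y) auto

lemma minus_one_power_mod_2: "n mod 2 = of_bit x \<Longrightarrow> (-1) ^ n = bit_sign x"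
  by (cases x) (auto simp: minus_one_power_iff odd_iff_mod_2_eq_one even_iff_mod_2_eq_zero)

lemma minus_one_power_div_2:
  assumes "n mod 4 = 2 * of_bit x"
  shows "(-1) ^ (n div 2) = bit_sign x"
proof -
  have "n div 2 mod 2 = n mod 4 div 2"
    by presburger
  then show ?thesis
    using assms by (intro minus_one_power_mod_2) simp
qed

lemma minus_one_power_div_4:
  assumes "n mod 8 = 4 * of_bit x"
  shows "(-1) ^ (n div 4) = bit_sign x"
proof -
  have "n div 4 mod 2 = n mod 8 div 4"
    by presburger
  then show ?thesis
    using assms by (intro minus_one_power_mod_2) simp
qed

text \<open>The bilinear part is upper triangular, so its diagonal is the part of
  \<open>cubic\<close> of degree at most 2; the three mixed terms add up on the diagonal to 3xyz =
  xyz. With all six entries equal to 1 this is the sign exponent in the product of the octonion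
  units.\<close>

definition cubic_cocycle :: "bit list \<Rightarrow> bit \<Rightarrow> bit \<Rightarrow> bit \<Rightarrow> bit \<Rightarrow> bit \<Rightarrow> bit \<Rightarrow> bit" where
  "cubic_cocycle ls x y z x' y' z' =
     ls!0 * x * x' + ls!1 * y * y' + ls!2 * z * z' + ls!3 * x * y' + ls!4 * x * z' + ls!5 * y * z'
     + x * y * z' + x * y' * z + x' * y * z"

text \<open>First polarization of the form; it is the exponent of the commutator sign, that is |v
  \<inter> w| / 2 modulo 2.\<close>

definition cubic_polar :: "bit list \<Rightarrow> bit \<Rightarrow> bit \<Rightarrow> bit \<Rightarrow> bit \<Rightarrow> bit \<Rightarrow> bit \<Rightarrow> bit" where
  "cubic_polar ls x y z x' y' z' =
     cubic ls x y z + cubic ls x' y' z' + cubic ls (x + x') (y + y') (z + z')"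

text \<open>Second polarization; it is the exponent of the associator sign, that is |v \<inter> w
  \<inter> u| modulo 2.\<close>

definition cubic_polar3 ::
  "bit list \<Rightarrow> bit \<Rightarrow> bit \<Rightarrow> bit \<Rightarrow> bit \<Rightarrow> bit \<Rightarrow> bit \<Rightarrow> bit \<Rightarrow> bit \<Rightarrow> bit \<Rightarrow> bit" where
  "cubic_polar3 ls x y z x' y' z' x'' y'' z'' =
     cubic_polar ls x y z x'' y'' z'' + cubic_polar ls x' y' z' x'' y'' z''
     + cubic_polar ls (x + x') (y + y') (z + z') x'' y'' z''"

lemma cubic_cocycle_self: "cubic_cocycle ls x y z x y z = cubic ls x y z"
  by (cases x; cases y; cases z) (simp_all add: cubic_cocycle_def cubic_def ac_simps)

lemma cubic_cocycle_swap:
  "cubic_cocycle ls x y z x' y' z' =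
     cubic_polar ls x y z x' y' z' + cubic_cocycle ls x' y' z' x y z"
  by (simp add: cubic_cocycle_def cubic_polar_def cubic_def distrib_left distrib_right ac_simps)

text \<open>A bilinear map satisfies the cocycle identity without correction, so the defect comes
  from the three mixed cubic terms alone. Expanding and cancelling equal terms in characteristic 2
  verifies it.\<close>

lemma cubic_cocycle_assoc:
  "cubic_cocycle ls (x + x') (y + y') (z + z') x'' y'' z'' =
     cubic_cocycle ls x y z (x' + x'') (y' + y'') (z' + z'') + cubic_cocycle ls x y z x' y' z'
     + cubic_cocycle ls x' y' z' x'' y'' z'' + cubic_polar3 ls x y z x' y' z' x'' y'' z''"
  by (simp add: cubic_cocycle_def cubic_polar3_def cubic_polar_def cubic_def
    distrib_left distrib_right ac_simps)

lemma frame_wt_times: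
  assumes "frame a b c ls"
  shows "wt (comb a b c x y z * comb a b c x' y' z') mod 4 = 2 * of_bit (cubic_polar ls x y z x' y' z')"
proof (subst polarize_mod_8[symmetric, OF wt_add])
  show "wt (comb a b c x y z + comb a b c x' y' z') mod 8 = 4 * of_bit
      (cubic ls x y z + cubic ls x' y' z' + cubic_polar ls x y z x' y' z')"
    by (simp add: comb_add frame_wt[OF assms] cubic_polar_def ac_simps)
qed (rule finite_supp_comb[OF assms] frame_wt[OF assms])+

lemma frame_wt_times3:
  assumes "frame a b c ls"
  shows "wt (comb a b c x y z * comb a b c x' y' z' * comb a b c x'' y'' z'') mod 2 =
    of_bit (cubic_polar3 ls x y z x' y' z' x'' y'' z'')"
proof (subst polarize_mod_4[symmetric, OF wt_add_times])
  show "wt ((comb a b c x y z + comb a b c x' y' z') * comb a b c x'' y'' z'') mod 4 = 2 * of_bit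
      (cubic_polar ls x y z x'' y'' z'' + cubic_polar ls x' y' z' x'' y'' z''
        + cubic_polar3 ls x y z x' y' z' x'' y'' z'')"
    by (simp only: comb_add frame_wt_times[OF assms] cubic_polar3_def) (simp add: ac_simps)
qed (rule finite_supp_comb[OF assms] frame_wt_times[OF assms])+

lemma code_cocycle_iff:
  "code_cocycle V \<phi> \<longleftrightarrow>
     (\<forall>v\<in>V. \<forall>w\<in>V. \<phi> v w \<in> {1, -1}) \<and>
     (\<forall>v\<in>V. \<phi> v v = (-1) ^ (wt v div 4)) \<and>
     (\<forall>v\<in>V. \<forall>w\<in>V. \<phi> v w = (-1) ^ (wt (v * w) div 2) * \<phi> w v) \<and>
     (\<forall>v\<in>V. \<phi> 0 v = 1 \<and> \<phi> v 0 = 1) \<and>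
     (\<forall>v\<in>V. \<forall>w\<in>V. \<forall>u\<in>V.
        \<phi> (v + w) u = \<phi> v (w + u) * \<phi> v w * \<phi> w u * (-1) ^ wt (v * w * u))"
  by (simp add: code_cocycle_def wt_def supp_times)

lemma frame_cocycle:
  assumes "frame a b c ls"
  obtains \<phi> where "code_cocycle (F2.span {a, b, c}) \<phi>"
proof -
  \<comment> \<open>\<open>co\<close> reads off coordinates, which are unique by
    \<open>frame_comb_inject\<close>. Its values outside the span are arbitrary.\<close>
  define co where "co = inv_into UNIV (\<lambda>(x, y, z). comb a b c x y z)"
  have "inj (\<lambda>(x, y, z). comb a b c x y z)"
    by (rule injI) (auto simp: frame_comb_inject[OF assms])
  then have co: "co (comb a b c x y z) = (x, y, z)" for x y z
    unfolding co_def using inv_f_f[of "\<lambda>(x, y, z). comb a b c x y z" "(x, y, z)"] by simp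
  define \<phi> where "\<phi> v w =
    (case co v of (x, y, z) \<Rightarrow> case co w of (x', y', z') \<Rightarrow> bit_sign (cubic_cocycle ls x y z x' y' z'))"
    for v w
  have \<phi>: "\<phi> (comb a b c x y z) (comb a b c x' y' z') = bit_sign (cubic_cocycle ls x y z x' y' z')"
    for x y z x' y' z'
    by (simp add: \<phi>_def co)
  note signs = minus_one_power_div_4[OF frame_wt[OF assms]]
    minus_one_power_div_2[OF frame_wt_times[OF assms]]
    minus_one_power_mod_2[OF frame_wt_times3[OF assms]]
  have "code_cocycle (F2.span {a, b, c}) \<phi>"
    unfolding code_cocycle_iff
  proof (intro conjI ballI; unfold span_triple mem_Collect_eq; elim exE)
    fix v w x y z x' y' z'
    assume v: "v = comb a b c x y z" and w: "w = comb a b c x' y' z'"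
    show "\<phi> v w \<in> {1, -1}"
      unfolding v w \<phi> by (cases "cubic_cocycle ls x y z x' y' z'") auto
    show "\<phi> v w = (-1) ^ (wt (v * w) div 2) * \<phi> w v"
      unfolding v w \<phi> signs bit_sign_add[symmetric] by (simp only: cubic_cocycle_swap[of ls x])
  next
    fix v x y z
    assume v: "v = comb a b c x y z"
    show "\<phi> v v = (-1) ^ (wt v div 4)"
      unfolding v \<phi> signs cubic_cocycle_self ..
    show "\<phi> 0 v = 1" "\<phi> v 0 = 1"
      using \<phi>[of 0 0 0 x y z] \<phi>[of x y z 0 0 0] by (simp_all add: v cubic_cocycle_def)
  next
    fix v w u x y z x' y' z' x'' y'' z''
    assume v: "v = comb a b c x y z" and w: "w = comb a b c x' y' z'"
      and u: "u = comb a b c x'' y'' z''"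
    show "\<phi> (v + w) u = \<phi> v (w + u) * \<phi> v w * \<phi> w u * (-1) ^ wt (v * w * u)"
      unfolding v w u comb_add \<phi> signs bit_sign_add[symmetric] cubic_cocycle_assoc ..
  qed
  then show thesis by (rule that)
qed

section \<open>Code loops\<close>

locale cocycle_code =
  fixes m :: nat and V :: "f2vec set" and \<phi> :: "f2vec \<Rightarrow> f2vec \<Rightarrow> int"
  assumes dec: "double_even_code m V" and cocycle: "code_cocycle V \<phi>"
begin

abbreviation "CL \<equiv> code_loop V \<phi>"

lemma zero_mem [simp]: "0 \<in> V"
  using dec double_even_code_subspace F2.subspace_0 by blast

lemma add_mem [simp]: "v \<in> V \<Longrightarrow> w \<in> V \<Longrightarrow> v + w \<in> V"
  using dec double_even_code_subspace F2.subspace_add by blast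

lemma cocycle_sign: "v \<in> V \<Longrightarrow> w \<in> V \<Longrightarrow> \<phi> v w = 1 \<or> \<phi> v w = -1"
  using cocycle unfolding code_cocycle_iff insert_iff by blast

lemma cocycle_square [simp]: "v \<in> V \<Longrightarrow> w \<in> V \<Longrightarrow> \<phi> v w * \<phi> v w = 1"
  using cocycle_sign[of v w] by auto

lemma cocycle_left_square [simp]: "v \<in> V \<Longrightarrow> w \<in> V \<Longrightarrow> \<phi> v w * (\<phi> v w * k) = k"
  using cocycle_sign[of v w] by auto

lemma cocycle_self: "v \<in> V \<Longrightarrow> \<phi> v v = (-1) ^ (wt v div 4)"
  using cocycle unfolding code_cocycle_iff by blast+

lemma cocycle_swap: "v \<in> V \<Longrightarrow> w \<in> V \<Longrightarrow> \<phi> v w = (-1) ^ (wt (v * w) div 2) * \<phi> w v"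
  using cocycle unfolding code_cocycle_iff by blast

lemma cocycle_zero [simp]: "v \<in> V \<Longrightarrow> \<phi> 0 v = 1" "v \<in> V \<Longrightarrow> \<phi> v 0 = 1"
  using cocycle unfolding code_cocycle_iff by blast+

lemma cocycle_assoc: "v \<in> V \<Longrightarrow> w \<in> V \<Longrightarrow> u \<in> V \<Longrightarrow>
    \<phi> (v + w) u = \<phi> v (w + u) * \<phi> v w * \<phi> w u * (-1) ^ wt (v * w * u)"
  using cocycle unfolding code_cocycle_iff by blast

lemma carrier_CL: "(e, v) \<in> carrier CL \<longleftrightarrow> (e = 1 \<or> e = -1) \<and> v \<in> V"
  by (auto simp: code_loop_def)

lemma mult_CL [simp]: "(e, v) \<otimes>\<^bsub>CL\<^esub> (d, w) = (e * d * \<phi> v w, v + w)"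
  by (simp add: code_loop_def)

lemma one_CL [simp]: "\<one>\<^bsub>CL\<^esub> = (1, 0)"
  by (simp add: code_loop_def)

lemma mult_carrier_CL: "x \<in> carrier CL \<Longrightarrow> y \<in> carrier CL \<Longrightarrow> x \<otimes>\<^bsub>CL\<^esub> y \<in> carrier CL"
  using cocycle_sign[of "snd x" "snd y"] by (cases x; cases y) (auto simp: carrier_CL)

lemma is_loop_CL: "is_loop CL"
proof -
  have "(\<exists>!x. x \<in> carrier CL \<and> a \<otimes>\<^bsub>CL\<^esub> x = b) \<and> (\<exists>!y. y \<in> carrier CL \<and> y \<otimes>\<^bsub>CL\<^esub> a = b)"
    if ab: "a \<in> carrier CL" "b \<in> carrier CL" for a b
  proof -
    obtain e v d w where a: "a = (e, v)" and b: "b = (d, w)"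
      by (cases a; cases b)
    have mem: "v \<in> V" "w \<in> V" "v + w \<in> V" "w + v \<in> V"
      and e: "e = 1 \<or> e = -1" and d: "d = 1 \<or> d = -1"
      using ab by (auto simp: a b carrier_CL)
    \<comment> \<open>Signs are their own inverses, as are vectors; hence both divisions have closed
      solutions.\<close>
    have sgn: "s * t * p = r \<longleftrightarrow> t = s * r * p" if "s = 1 \<or> s = -1" "p = 1 \<or> p = -1" for s t p r :: int
      using that by auto
    have left: "(e, v) \<otimes>\<^bsub>CL\<^esub> x = (d, w) \<longleftrightarrow> x = (e * d * \<phi> v (v + w), v + w)" for x
    proof -
      obtain d' w' where x: "x = (d', w')"
        by (cases x)
      have eq: "v + w' = w \<longleftrightarrow> w' = v + w"
        using f2vec_add_eq_iff[of w' v w] by (simp add: add.commute)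
      show ?thesis
        unfolding x mult_CL prod.inject eq
        by (cases "w' = v + w") (simp_all only: sgn[OF e cocycle_sign[OF mem(1,3)]] simp_thms)
    qed
    have right: "x \<otimes>\<^bsub>CL\<^esub> (e, v) = (d, w) \<longleftrightarrow> x = (e * d * \<phi> (w + v) v, w + v)" for x
    proof -
      obtain d' w' where x: "x = (d', w')"
        by (cases x)
      show ?thesis
        unfolding x mult_CL prod.inject f2vec_add_eq_iff[of w' v w] mult.commute[of d' e]
        by (cases "w' = w + v") (simp_all only: sgn[OF e cocycle_sign[OF mem(4,1)]] simp_thms)
    qed
    have carrier: "(e * d * \<phi> v (v + w), v + w) \<in> carrier CL" "(e * d * \<phi> (w + v) v, w + v) \<in> carrier CL"
      using e d mem cocycle_sign[OF mem(1,3)] cocycle_sign[OF mem(4,1)] by (auto simp: carrier_CL)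
    have "\<exists>!x. x \<in> A \<and> x = y" if "y \<in> A" for y :: "int \<times> f2vec" and A
      using that by auto
    from this[OF carrier(1)] this[OF carrier(2)] show ?thesis
      unfolding a b left right ..
  qed
  note division = this
  have one: "\<one>\<^bsub>CL\<^esub> \<in> carrier CL" and unit: "\<forall>x\<in>carrier CL. \<one>\<^bsub>CL\<^esub> \<otimes>\<^bsub>CL\<^esub> x = x \<and> x \<otimes>\<^bsub>CL\<^esub> \<one>\<^bsub>CL\<^esub> = x"
    by (auto simp: carrier_CL)
  show ?thesis
    unfolding is_loop_def
    by (rule conjI, rule one, rule conjI, intro ballI mult_carrier_CL, assumption, assumption,
      rule conjI, rule unit, intro ballI division)
qed

lemma square_CL: "v \<in> V \<Longrightarrow> e = 1 \<or> e = -1 \<Longrightarrow> (e, v) \<otimes>\<^bsub>CL\<^esub> (e, v) = ((-1) ^ (wt v div 4), 0)"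
  by (auto simp: cocycle_self)

text \<open>\<open>m_inv\<close> is a definite description, so uniqueness is required before it can
  be evaluated. The vector part must be \<open>v\<close> itself, which then forces the sign.\<close>

lemma inv_CL_unique:
  assumes "(e, v) \<in> carrier CL" "y \<in> carrier CL"
  shows "(e, v) \<otimes>\<^bsub>CL\<^esub> y = \<one>\<^bsub>CL\<^esub> \<and> y \<otimes>\<^bsub>CL\<^esub> (e, v) = \<one>\<^bsub>CL\<^esub> \<longleftrightarrow> y = (e * \<phi> v v, v)"
proof -
  obtain d w where y: "y = (d, w)"
    by (cases y)
  have "w + v = 0 \<longleftrightarrow> w = v" "v + w = 0 \<longleftrightarrow> w = v"
    using f2vec_add_eq_iff[of w v 0] by (simp_all add: add.commute)
  then show ?thesis
    using assms cocycle_sign[of v v] by (auto simp: y carrier_CL)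
qed

lemma inv_carrier_CL: "(e, v) \<in> carrier CL \<Longrightarrow> (e * \<phi> v v, v) \<in> carrier CL"
  using cocycle_sign[of v v] by (auto simp: carrier_CL)

lemma inv_CL:
  assumes "(e, v) \<in> carrier CL"
  shows "inv\<^bsub>CL\<^esub> (e, v) = (e * \<phi> v v, v)"
  unfolding m_inv_def
proof (rule the_equality)
  fix y assume "y \<in> carrier CL \<and> (e, v) \<otimes>\<^bsub>CL\<^esub> y = \<one>\<^bsub>CL\<^esub> \<and> y \<otimes>\<^bsub>CL\<^esub> (e, v) = \<one>\<^bsub>CL\<^esub>"
  then show "y = (e * \<phi> v v, v)"
    using inv_CL_unique[OF assms] by blast
qed (use inv_carrier_CL[OF assms] inv_CL_unique[OF assms] in blast)

lemma commutator_CL: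
  assumes "(e, v) \<in> carrier CL" "(d, w) \<in> carrier CL"
  shows "loop_commutator CL (e, v) (d, w) = ((-1) ^ (wt (v * w) div 2), 0)"
proof -
  have mem: "v \<in> V" "w \<in> V" and sgn: "e * e = 1" "d * d = 1"
    using assms by (auto simp: carrier_CL)
  \<comment> \<open>The associator of \<open>w\<close>, \<open>v\<close>, \<open>v\<close> is
    trivial, because the triple intersection is just that of \<open>w\<close> and \<open>v\<close>,
    which has even size.\<close>
  have "even (wt (w * v * v))"
    using dec mem unfolding double_even_code_def by (auto simp: wt_def supp_times Int_assoc)
  then have "\<phi> (w + v) v = \<phi> w v * \<phi> v v"
    using cocycle_assoc[of w v v] mem by simp
  then have "loop_commutator CL (e, v) (d, w) =
      ((e * e) * (d * d) * ((\<phi> v v * \<phi> v v) * (\<phi> w w * \<phi> w w) * \<phi> v w * \<phi> w v), 0)"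
    using mem by (simp add: loop_commutator_def inv_CL[OF assms(1)] inv_CL[OF assms(2)] ac_simps
        del: cocycle_square cocycle_left_square)
  also have "\<dots> = (\<phi> v w * \<phi> w v, 0)"
    using mem sgn by simp
  also have "\<dots> = ((-1) ^ (wt (v * w) div 2), 0)"
    using cocycle_swap[OF mem] mem by (simp add: mult.assoc)
  finally show ?thesis .
qed

text \<open>Stating the associator as a left factor avoids inverses and gives an equation that
  isomorphisms transport directly.\<close>

lemma assoc_CL:
  assumes "v \<in> V" "w \<in> V" "u \<in> V"
  shows "((e, v) \<otimes>\<^bsub>CL\<^esub> (d, w)) \<otimes>\<^bsub>CL\<^esub> (f, u) =
    ((-1) ^ wt (v * w * u), 0) \<otimes>\<^bsub>CL\<^esub> ((e, v) \<otimes>\<^bsub>CL\<^esub> ((d, w) \<otimes>\<^bsub>CL\<^esub> (f, u)))"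
  using assms by (simp add: cocycle_assoc ac_simps)

lemma nonassociative_CL:
  "nonassociative CL \<longleftrightarrow> (\<exists>u\<in>V. \<exists>v\<in>V. \<exists>w\<in>V. odd (wt (u * v * w)))"
proof
  assume "nonassociative CL"
  then obtain e v d w f u where mem: "(e, v) \<in> carrier CL" "(d, w) \<in> carrier CL" "(f, u) \<in> carrier CL"
    and ne: "((e, v) \<otimes>\<^bsub>CL\<^esub> (d, w)) \<otimes>\<^bsub>CL\<^esub> (f, u) \<noteq> (e, v) \<otimes>\<^bsub>CL\<^esub> ((d, w) \<otimes>\<^bsub>CL\<^esub> (f, u))"
    unfolding nonassociative_def by fast
  then have "odd (wt (v * w * u))"
    using assoc_CL[of v w u e d f] by (auto simp: carrier_CL simp del: minus_one_power_iff)
  then show "\<exists>u\<in>V. \<exists>v\<in>V. \<exists>w\<in>V. odd (wt (u * v * w))"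
    using mem by (auto simp: carrier_CL)
next
  assume "\<exists>u\<in>V. \<exists>v\<in>V. \<exists>w\<in>V. odd (wt (u * v * w))"
  then obtain u v w where mem: "u \<in> V" "v \<in> V" "w \<in> V" and odd: "odd (wt (u * v * w))"
    by blast
  have "((1, u) \<otimes>\<^bsub>CL\<^esub> (1, v)) \<otimes>\<^bsub>CL\<^esub> (1, w) \<noteq> (1, u) \<otimes>\<^bsub>CL\<^esub> ((1, v) \<otimes>\<^bsub>CL\<^esub> (1, w))"
    unfolding assoc_CL[OF mem] using mem odd cocycle_sign[of v w] cocycle_sign[of u "v + w"] by auto
  then show "nonassociative CL"
    unfolding nonassociative_def using mem
    by (intro bexI[of _ "(1, u)"] bexI[of _ "(1, v)"] bexI[of _ "(1, w)"]) (auto simp: carrier_CL)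
qed

end

section \<open>Transport of units, inverses and commutators along loop isomorphisms\<close>

lemma is_loopD:
  assumes "is_loop L"
  shows "\<one>\<^bsub>L\<^esub> \<in> carrier L" "x \<in> carrier L \<Longrightarrow> y \<in> carrier L \<Longrightarrow> x \<otimes>\<^bsub>L\<^esub> y \<in> carrier L"
    "x \<in> carrier L \<Longrightarrow> \<one>\<^bsub>L\<^esub> \<otimes>\<^bsub>L\<^esub> x = x" "x \<in> carrier L \<Longrightarrow> x \<otimes>\<^bsub>L\<^esub> \<one>\<^bsub>L\<^esub> = x"
  using assms by (simp_all add: is_loop_def)

lemma isoD:
  assumes "h \<in> iso L M"
  shows "x \<in> carrier L \<Longrightarrow> h x \<in> carrier M"
    "x \<in> carrier L \<Longrightarrow> y \<in> carrier L \<Longrightarrow> h (x \<otimes>\<^bsub>L\<^esub> y) = h x \<otimes>\<^bsub>M\<^esub> h y"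
    "x \<in> carrier L \<Longrightarrow> y \<in> carrier L \<Longrightarrow> h x = h y \<longleftrightarrow> x = y"
    "z \<in> carrier M \<Longrightarrow> \<exists>x\<in>carrier L. h x = z"
  using assms by (auto simp: iso_def hom_def bij_betw_def inj_on_def) (metis imageE)

lemma iso_loop_inverse:
  assumes L: "is_loop L" and h: "h \<in> iso L M"
  obtains k where "k \<in> iso M L" "\<And>x. x \<in> carrier L \<Longrightarrow> k (h x) = x"
proof -
  define k where "k = inv_into (carrier L) h"
  have bij: "bij_betw h (carrier L) (carrier M)"
    using h by (simp add: iso_def)
  have kh: "k (h x) = x" if "x \<in> carrier L" for x
    using bij that by (simp add: k_def bij_betw_def)
  have "k \<in> hom M L"
  proof (rule homI)
    fix x y assume "x \<in> carrier M" "y \<in> carrier M"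
    then obtain x' y' where xy: "x' \<in> carrier L" "y' \<in> carrier L" "x = h x'" "y = h y'"
      using isoD(4)[OF h] by metis
    then show "k x \<in> carrier L"
      by (simp add: kh)
    have "k (h (x' \<otimes>\<^bsub>L\<^esub> y')) = x' \<otimes>\<^bsub>L\<^esub> y'"
      using xy by (intro kh is_loopD(2)[OF L])
    then show "k (x \<otimes>\<^bsub>M\<^esub> y) = k x \<otimes>\<^bsub>L\<^esub> k y"
      using xy by (simp add: kh isoD(2)[OF h])
  qed
  then have "k \<in> iso M L"
    using bij by (simp add: iso_def k_def bij_betw_inv_into)
  then show thesis
    using kh by (rule that)
qed

lemma iso_nonassociative:
  assumes L: "is_loop L" and h: "h \<in> iso L M"
  shows "nonassociative M \<longleftrightarrow> nonassociative L"
proof -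
  have img: "carrier M = h ` carrier L"
    using h by (simp add: iso_def bij_betw_def)
  show ?thesis
    by (simp add: nonassociative_def img isoD[OF h] is_loopD(2)[OF L] flip: isoD(2)[OF h])
qed

lemma iso_loop_one:
  assumes L: "is_loop L" and M: "is_loop M" and h: "h \<in> iso L M"
  shows "h \<one>\<^bsub>L\<^esub> = \<one>\<^bsub>M\<^esub>"
proof -
  obtain x where x: "x \<in> carrier L" "h x = \<one>\<^bsub>M\<^esub>"
    using isoD(4)[OF h is_loopD(1)[OF M]] by blast
  have "h \<one>\<^bsub>L\<^esub> = h \<one>\<^bsub>L\<^esub> \<otimes>\<^bsub>M\<^esub> h x"
    using x isoD(1)[OF h] is_loopD[OF L] is_loopD[OF M] by simp
  also have "\<dots> = h x"
    using x is_loopD[OF L] isoD(2)[OF h] by metis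
  finally show ?thesis
    using x by simp
qed

text \<open>The value of a definite description transfers only when it is well determined;
  \<open>ex\<close> provides this in \<open>M\<close>, and the isomorphism carries it back to
  \<open>L\<close>.\<close>

lemma iso_loop_inv:
  assumes L: "is_loop L" and M: "is_loop M" and h: "h \<in> iso L M" and x: "x \<in> carrier L"
    and ex: "\<exists>!y. y \<in> carrier M \<and> h x \<otimes>\<^bsub>M\<^esub> y = \<one>\<^bsub>M\<^esub> \<and> y \<otimes>\<^bsub>M\<^esub> h x = \<one>\<^bsub>M\<^esub>"
  shows "inv\<^bsub>L\<^esub> x \<in> carrier L" "h (inv\<^bsub>L\<^esub> x) = inv\<^bsub>M\<^esub> (h x)"
proof -
  have inv_iff: "x \<otimes>\<^bsub>L\<^esub> y = \<one>\<^bsub>L\<^esub> \<and> y \<otimes>\<^bsub>L\<^esub> x = \<one>\<^bsub>L\<^esub> \<longleftrightarrow>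
      h x \<otimes>\<^bsub>M\<^esub> h y = \<one>\<^bsub>M\<^esub> \<and> h y \<otimes>\<^bsub>M\<^esub> h x = \<one>\<^bsub>M\<^esub>" if "y \<in> carrier L" for y
    using x that is_loopD[OF L] iso_loop_one[OF L M h] isoD(2,3)[OF h] by metis
  have inv_M: "inv\<^bsub>M\<^esub> (h x) \<in> carrier M \<and> h x \<otimes>\<^bsub>M\<^esub> inv\<^bsub>M\<^esub> (h x) = \<one>\<^bsub>M\<^esub> \<and>
      inv\<^bsub>M\<^esub> (h x) \<otimes>\<^bsub>M\<^esub> h x = \<one>\<^bsub>M\<^esub>"
    unfolding m_inv_def by (rule theI'[OF ex])
  then obtain y where y: "y \<in> carrier L" "h y = inv\<^bsub>M\<^esub> (h x)"
    using isoD(4)[OF h] by blast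
  have "inv\<^bsub>L\<^esub> x = y"
    unfolding m_inv_def
  proof (rule the_equality)
    show "y \<in> carrier L \<and> x \<otimes>\<^bsub>L\<^esub> y = \<one>\<^bsub>L\<^esub> \<and> y \<otimes>\<^bsub>L\<^esub> x = \<one>\<^bsub>L\<^esub>"
      using y inv_M inv_iff by simp
  next
    fix z assume z: "z \<in> carrier L \<and> x \<otimes>\<^bsub>L\<^esub> z = \<one>\<^bsub>L\<^esub> \<and> z \<otimes>\<^bsub>L\<^esub> x = \<one>\<^bsub>L\<^esub>"
    then have "h z = h y"
      using inv_iff y inv_M ex isoD(1)[OF h] by metis
    then show "z = y"
      using y z isoD(3)[OF h] by blast
  qed
  then show "inv\<^bsub>L\<^esub> x \<in> carrier L" "h (inv\<^bsub>L\<^esub> x) = inv\<^bsub>M\<^esub> (h x)"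
    using y by auto
qed

context cocycle_code
begin

lemma iso_commutator:
  assumes L: "is_loop L" and h: "h \<in> iso L CL" and x: "x \<in> carrier L" and y: "y \<in> carrier L"
  shows "loop_commutator L x y \<in> carrier L"
    "h (loop_commutator L x y) = ((-1) ^ (wt (snd (h x) * snd (h y)) div 2), 0)"
proof -
  have "\<exists>!z. z \<in> carrier CL \<and> w \<otimes>\<^bsub>CL\<^esub> z = \<one>\<^bsub>CL\<^esub> \<and> z \<otimes>\<^bsub>CL\<^esub> w = \<one>\<^bsub>CL\<^esub>"
    if "w \<in> carrier CL" for w
    using that inv_CL_unique inv_carrier_CL by (cases w) metis
  then have inv: "inv\<^bsub>L\<^esub> z \<in> carrier L" "h (inv\<^bsub>L\<^esub> z) = inv\<^bsub>CL\<^esub> (h z)" if "z \<in> carrier L" for z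
    using iso_loop_inv[OF L is_loop_CL h that] isoD(1)[OF h that] by blast+
  show "loop_commutator L x y \<in> carrier L"
    using x y by (simp add: loop_commutator_def inv is_loopD(2)[OF L])
  have "h (loop_commutator L x y) = loop_commutator CL (h x) (h y)"
    using x y by (simp add: loop_commutator_def isoD(2)[OF h] inv is_loopD(2)[OF L])
  also have "\<dots> = ((-1) ^ (wt (snd (h x) * snd (h y)) div 2), 0)"
    using commutator_CL[of "fst (h x)" "snd (h x)" "fst (h y)" "snd (h y)"] isoD(1)[OF h] x y by simp
  finally show "h (loop_commutator L x y) = ((-1) ^ (wt (snd (h x) * snd (h y)) div 2), 0)" .
qed

end

section \<open>Isomorphisms and weights modulo 8\<close>

lemma iso_code_loops_additive_map:
  assumes "cocycle_code m V \<phi>" "cocycle_code m' V' \<phi>'"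
    and nonassoc: "nonassociative (code_loop V \<phi>)"
    and k: "k \<in> iso (code_loop V \<phi>) (code_loop V' \<phi>')"
  obtains T where "\<And>v. v \<in> V \<Longrightarrow> T v \<in> V'"
    "\<And>v w. v \<in> V \<Longrightarrow> w \<in> V \<Longrightarrow> T (v + w) = T v + T w"
    "\<And>v. v \<in> V \<Longrightarrow> wt (T v) mod 8 = wt v mod 8"
proof -
  interpret A: cocycle_code m V \<phi> by fact
  interpret B: cocycle_code m' V' \<phi>' by fact
  define T where "T v = snd (k (1, v))" for v
  have carrier: "(1, v) \<in> carrier A.CL" "(-1, v) \<in> carrier A.CL" if "v \<in> V" for v
    using that by (simp_all add: A.carrier_CL)
  have k_carrier: "k (e, v) \<in> carrier B.CL" if "(e, v) \<in> carrier A.CL" for e v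
    using isoD(1)[OF k that] .
  have k_mult: "k (x \<otimes>\<^bsub>A.CL\<^esub> y) = k x \<otimes>\<^bsub>B.CL\<^esub> k y" if "x \<in> carrier A.CL" "y \<in> carrier A.CL" for x y
    using isoD(2)[OF k that] .
  have k_one: "k (1, 0) = (1, 0)"
    using iso_loop_one[OF A.is_loop_CL B.is_loop_CL k] by simp
  have k_minus_one: "k (-1, 0) = (-1, 0)"
  proof -
    \<comment> \<open>A triple with associator -1. Its image satisfies the same kind of equation
      with some sign \<open>s\<close>, and cancelling \<open>p\<close> on the right identifies
      \<open>k (-1, 0)\<close> with \<open>(s, 0)\<close>. Injectivity then rules out
      \<open>s = 1\<close>.\<close>
    obtain u v w where uvw: "u \<in> V" "v \<in> V" "w \<in> V" and odd: "odd (wt (u * v * w))"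
      using nonassoc A.nonassociative_CL by blast
    define x y z where "x = ((1::int), u)" and "y = ((1::int), v)" and "z = ((1::int), w)"
    have mem: "x \<in> carrier A.CL" "y \<in> carrier A.CL" "z \<in> carrier A.CL"
      using uvw carrier by (auto simp: x_def y_def z_def)
    define p where "p = k (x \<otimes>\<^bsub>A.CL\<^esub> (y \<otimes>\<^bsub>A.CL\<^esub> z))"
    have "(x \<otimes>\<^bsub>A.CL\<^esub> y) \<otimes>\<^bsub>A.CL\<^esub> z = (-1, 0) \<otimes>\<^bsub>A.CL\<^esub> (x \<otimes>\<^bsub>A.CL\<^esub> (y \<otimes>\<^bsub>A.CL\<^esub> z))"
      using A.assoc_CL[OF uvw, of 1 1 1] odd unfolding x_def y_def z_def by simp
    then have 1: "k (-1, 0) \<otimes>\<^bsub>B.CL\<^esub> p = (k x \<otimes>\<^bsub>B.CL\<^esub> k y) \<otimes>\<^bsub>B.CL\<^esub> k z"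
      using mem carrier A.mult_carrier_CL unfolding p_def by (metis k_mult A.zero_mem)
    obtain e u' where x': "k x = (e, u')" by (cases "k x")
    obtain d v' where y': "k y = (d, v')" by (cases "k y")
    obtain f w' where z': "k z = (f, w')" by (cases "k z")
    have mem': "u' \<in> V'" "v' \<in> V'" "w' \<in> V'"
      using mem isoD(1)[OF k] x' y' z' B.carrier_CL by metis+
    have p: "p = k x \<otimes>\<^bsub>B.CL\<^esub> (k y \<otimes>\<^bsub>B.CL\<^esub> k z)"
      unfolding p_def using mem A.mult_carrier_CL by (simp only: k_mult)
    define s :: int where "s = (-1) ^ wt (u' * v' * w')"
    have s: "s = 1 \<or> s = -1"
      by (auto simp: s_def minus_one_power_iff)
    have 2: "(s, 0) \<otimes>\<^bsub>B.CL\<^esub> p = (k x \<otimes>\<^bsub>B.CL\<^esub> k y) \<otimes>\<^bsub>B.CL\<^esub> k z"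
      unfolding p x' y' z' s_def by (rule B.assoc_CL[OF mem', symmetric])
    have p_carrier: "p \<in> carrier B.CL"
      unfolding p_def using mem A.mult_carrier_CL by (intro isoD(1)[OF k]) blast
    have "k (-1, 0) = (s, 0)"
    proof -
      have "k (-1, 0) \<in> carrier B.CL" "(s, 0) \<in> carrier B.CL"
        "(k x \<otimes>\<^bsub>B.CL\<^esub> k y) \<otimes>\<^bsub>B.CL\<^esub> k z \<in> carrier B.CL"
        using s carrier mem B.mult_carrier_CL isoD(1)[OF k] by (simp_all add: B.carrier_CL)
      then show ?thesis
        using 1 2 p_carrier B.is_loop_CL unfolding is_loop_def by metis
    qed
    moreover have "k (-1, 0) \<noteq> k (1, 0)"
      using isoD(3)[OF k, of "(-1, 0)" "(1, 0)"] carrier by simp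
    ultimately show ?thesis
      using s k_one by auto
  qed
  have k_sign: "k (s, 0) = (s, 0)" if "s = 1 \<or> s = -1" for s
    using that k_one k_minus_one by auto
  have T_mem: "T v \<in> V'" if "v \<in> V" for v
    using k_carrier[OF carrier(1)[OF that]] B.carrier_CL[of "fst (k (1, v))" "snd (k (1, v))"]
    by (simp add: T_def)
  have snd_mult: "snd (x \<otimes>\<^bsub>B.CL\<^esub> y) = snd x + snd y" for x y
    by (cases x; cases y) simp
  \<comment> \<open>\<open>T\<close> ignores the sign of the representative. Additivity depends on
    this, since the product of \<open>(1, v)\<close> and \<open>(1, w)\<close> carries the sign
    \<open>\<phi> v w\<close>.\<close>
  have T_sign: "snd (k (s, v)) = T v" if "v \<in> V" "s = 1 \<or> s = -1" for s v
  proof -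
    have "k (s, v) = k ((s, 0) \<otimes>\<^bsub>A.CL\<^esub> (1, v))"
      using that by simp
    also have "\<dots> = (s, 0) \<otimes>\<^bsub>B.CL\<^esub> k (1, v)"
      using that carrier k_sign by (subst k_mult) (auto simp: A.carrier_CL)
    finally show ?thesis
      by (simp add: snd_mult T_def)
  qed
  show thesis
  proof (rule that[of T])
    show "T v \<in> V'" if "v \<in> V" for v
      using that by (rule T_mem)
    show "T (v + w) = T v + T w" if "v \<in> V" "w \<in> V" for v w
    proof -
      have "T v + T w = snd (k ((1, v) \<otimes>\<^bsub>A.CL\<^esub> (1, w)))"
        using that carrier by (simp only: k_mult snd_mult T_def)
      also have "\<dots> = T (v + w)"
        using that A.cocycle_sign[OF that] T_sign[of "v + w" "\<phi> v w"] by simp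
      finally show ?thesis ..
    qed
    show "wt (T v) mod 8 = wt v mod 8" if v: "v \<in> V" for v
    proof -
      obtain e where e: "k (1, v) = (e, T v)" "e = 1 \<or> e = -1"
        using k_carrier[OF carrier(1)[OF v]] B.carrier_CL by (metis T_def prod.collapse)
      have "((-1) ^ (wt v div 4), 0) = k ((1, v) \<otimes>\<^bsub>A.CL\<^esub> (1, v))"
        using A.square_CL[OF v, of 1] k_sign[of "(-1) ^ (wt v div 4)"]
        by (simp add: minus_one_power_iff)
      also have "\<dots> = ((-1) ^ (wt (T v) div 4), 0)"
        using carrier v e T_mem B.square_CL by (simp only: k_mult)
      finally have "even (wt v div 4) \<longleftrightarrow> even (wt (T v) div 4)"
        by (simp add: minus_one_power_iff split: if_splits)
      moreover have "wt v mod 4 = 0" "wt (T v) mod 4 = 0"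
        using double_even_codeD(3)[OF A.dec that] double_even_codeD(3)[OF B.dec T_mem[OF v]] .
      \<comment> \<open>Squares reveal only the parity of |v| / 4; divisibility by 4 completes this
        to the weight modulo 8.\<close>
      moreover have "p mod 8 = q mod 8" if "even (p div 4) \<longleftrightarrow> even (q div 4)" "p mod 4 = 0" "q mod 4 = 0"
        for p q :: nat
        using that by presburger
      ultimately show ?thesis
        by metis
    qed
  qed
qed

text \<open>Over F_2 the only scalars are 0 and 1, so additive maps are linear.\<close>

lemma additive_comb:
  assumes add: "\<And>v w. v \<in> F2.span {a, b, c} \<Longrightarrow> w \<in> F2.span {a, b, c} \<Longrightarrow> T (v + w) = T v + T w"
  shows "T (comb a b c x y z) = comb (T a) (T b) (T c) x y z"
proof -
  have zero: "T 0 = 0"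
    using add[of 0 0] F2.span_zero[of "{a, b, c}"] by simp
  have mem: "f2_scale x a \<in> F2.span {a, b, c}" "f2_scale y b \<in> F2.span {a, b, c}" "f2_scale z c \<in> F2.span {a, b, c}"
    by (auto intro: F2.span_scale F2.span_base)
  have scale: "T (f2_scale s v) = f2_scale s (T v)" for s v
    using zero by (cases s) auto
  show ?thesis
    unfolding comb_def using mem by (simp add: add F2.span_add scale)
qed

lemma frame_transport:
  assumes "frame a b c ls"
    and T: "\<And>v w. v \<in> F2.span {a, b, c} \<Longrightarrow> w \<in> F2.span {a, b, c} \<Longrightarrow> T (v + w) = T v + T w"
    "\<And>v. v \<in> F2.span {a, b, c} \<Longrightarrow> wt (T v) mod 8 = wt v mod 8"
    and "finite (supp (T a))" "finite (supp (T b))" "finite (supp (T c))"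
  shows "frame (T a) (T b) (T c) ls"
  using assms by (simp add: frame_def flip: additive_comb[OF T(1)])

text \<open>Matching coordinates gives a linear bijection \<open>T\<close> with inverse
  \<open>S\<close>, and \<open>\<phi>\<close> is pulled back along \<open>S\<close>. This makes
  \<open>T\<close> an isomorphism by construction, so that no two given cocycles on the same code
  have to be compared.\<close>

lemma frame_code_loop_iso:
  assumes F: "frame a b c ls" and F': "frame a' b' c' ls"
    and coc: "code_cocycle (F2.span {a, b, c}) \<phi>"
  obtains \<phi>' where "code_cocycle (F2.span {a', b', c'}) \<phi>'"
    "code_loop (F2.span {a, b, c}) \<phi> \<cong> code_loop (F2.span {a', b', c'}) \<phi>'"
proof -
  define S where "S = (\<lambda>(x, y, z). comb a b c x y z) \<circ> inv_into UNIV (\<lambda>(x, y, z). comb a' b' c' x y z)"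
  define T where "T = (\<lambda>(x, y, z). comb a' b' c' x y z) \<circ> inv_into UNIV (\<lambda>(x, y, z). comb a b c x y z)"
  have "inj (\<lambda>(x, y, z). comb a b c x y z)" "inj (\<lambda>(x, y, z). comb a' b' c' x y z)"
    by (auto intro!: injI simp: frame_comb_inject[OF F] frame_comb_inject[OF F'])
  note inv = this[THEN inv_f_f]
  have S: "S (comb a' b' c' x y z) = comb a b c x y z" for x y z
    unfolding S_def using inv(2)[of "(x, y, z)"] by simp
  have T: "T (comb a b c x y z) = comb a' b' c' x y z" for x y z
    unfolding T_def using inv(1)[of "(x, y, z)"] by simp
  define \<phi>' where "\<phi>' v w = \<phi> (S v) (S w)" for v w
  have S0: "S 0 = 0"
    using S[of 0 0 0] by simp
  have S_mem: "S v \<in> F2.span {a, b, c}" if "v \<in> F2.span {a', b', c'}" for v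
    using that comb_in_span S unfolding span_triple[of a' b' c'] by fastforce
  have T_mem: "T v \<in> F2.span {a', b', c'}" if "v \<in> F2.span {a, b, c}" for v
    using that comb_in_span T unfolding span_triple[of a b c] by fastforce
  have S_T: "S (T v) = v" if "v \<in> F2.span {a, b, c}" for v
    using that by (auto simp: span_triple S T)
  have T_S: "T (S v) = v" if "v \<in> F2.span {a', b', c'}" for v
    using that by (auto simp: span_triple S T)
  have S_add: "S (v + w) = S v + S w" if "v \<in> F2.span {a', b', c'}" "w \<in> F2.span {a', b', c'}" for v w
    using that by (auto simp: span_triple S comb_add)
  \<comment> \<open>The weights of \<open>v\<close> and \<open>S v\<close> may differ, but their
    residues are given by the same form, so the signs in the cocycle conditions agree.\<close>
  have wt1: "(-1::int) ^ (wt (S v) div 4) = (-1) ^ (wt v div 4)" if "v \<in> F2.span {a', b', c'}" for v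
    using that minus_one_power_div_4[OF frame_wt[OF F]] minus_one_power_div_4[OF frame_wt[OF F']]
    by (auto simp: span_triple S)
  have wt2: "(-1::int) ^ (wt (S v * S w) div 2) = (-1) ^ (wt (v * w) div 2)"
    if "v \<in> F2.span {a', b', c'}" "w \<in> F2.span {a', b', c'}" for v w
    using that minus_one_power_div_2[OF frame_wt_times[OF F]] minus_one_power_div_2[OF frame_wt_times[OF F']]
    by (auto simp: span_triple S)
  have wt3: "(-1::int) ^ wt (S v * S w * S u) = (-1) ^ wt (v * w * u)"
    if "v \<in> F2.span {a', b', c'}" "w \<in> F2.span {a', b', c'}" "u \<in> F2.span {a', b', c'}" for v w u
    using that minus_one_power_mod_2[OF frame_wt_times3[OF F]] minus_one_power_mod_2[OF frame_wt_times3[OF F']]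
    by (auto simp: span_triple S)
  have \<phi>: "v \<in> F2.span {a, b, c} \<Longrightarrow> w \<in> F2.span {a, b, c} \<Longrightarrow> \<phi> v w \<in> {1, -1}"
    "v \<in> F2.span {a, b, c} \<Longrightarrow> \<phi> v v = (-1) ^ (wt v div 4)"
    "v \<in> F2.span {a, b, c} \<Longrightarrow> w \<in> F2.span {a, b, c} \<Longrightarrow> \<phi> v w = (-1) ^ (wt (v * w) div 2) * \<phi> w v"
    "v \<in> F2.span {a, b, c} \<Longrightarrow> \<phi> 0 v = 1" "v \<in> F2.span {a, b, c} \<Longrightarrow> \<phi> v 0 = 1"
    "v \<in> F2.span {a, b, c} \<Longrightarrow> w \<in> F2.span {a, b, c} \<Longrightarrow> u \<in> F2.span {a, b, c} \<Longrightarrow>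
      \<phi> (v + w) u = \<phi> v (w + u) * \<phi> v w * \<phi> w u * (-1) ^ wt (v * w * u)" for v w u
    using coc unfolding code_cocycle_iff by blast+
  have coc': "code_cocycle (F2.span {a', b', c'}) \<phi>'"
    unfolding code_cocycle_iff
  proof (intro conjI ballI)
    fix v assume v: "v \<in> F2.span {a', b', c'}"
    show "\<phi>' v v = (-1) ^ (wt v div 4)" "\<phi>' 0 v = 1" "\<phi>' v 0 = 1"
      using \<phi>(2,4,5)[OF S_mem[OF v]] wt1[OF v] by (simp_all add: \<phi>'_def S0)
    fix w assume w: "w \<in> F2.span {a', b', c'}"
    show "\<phi>' v w \<in> {1, -1}"
      unfolding \<phi>'_def by (rule \<phi>(1)[OF S_mem[OF v] S_mem[OF w]])
    show "\<phi>' v w = (-1) ^ (wt (v * w) div 2) * \<phi>' w v"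
      unfolding \<phi>'_def wt2[OF v w, symmetric] by (rule \<phi>(3)[OF S_mem[OF v] S_mem[OF w]])
    fix u assume u: "u \<in> F2.span {a', b', c'}"
    show "\<phi>' (v + w) u = \<phi>' v (w + u) * \<phi>' v w * \<phi>' w u * (-1) ^ wt (v * w * u)"
      unfolding \<phi>'_def wt3[OF v w u, symmetric] S_add[OF v w] S_add[OF w u]
      by (rule \<phi>(6)[OF S_mem[OF v] S_mem[OF w] S_mem[OF u]])
  qed
  have T_add: "T (v + w) = T v + T w" if "v \<in> F2.span {a, b, c}" "w \<in> F2.span {a, b, c}" for v w
    using that by (auto simp: span_triple T comb_add)
  have "map_prod id T \<in> iso (code_loop (F2.span {a, b, c}) \<phi>) (code_loop (F2.span {a', b', c'}) \<phi>')"
  proof -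
    have "bij_betw T (F2.span {a, b, c}) (F2.span {a', b', c'})"
      by (rule bij_betw_byWitness[of _ S]) (auto simp: S_T T_S S_mem T_mem)
    then have "bij_betw (map_prod id T) ({1::int, -1} \<times> F2.span {a, b, c}) ({1, -1} \<times> F2.span {a', b', c'})"
      by (intro bij_betw_map_prod) auto
    moreover have "map_prod id T \<in> hom (code_loop (F2.span {a, b, c}) \<phi>) (code_loop (F2.span {a', b', c'}) \<phi>')"
      by (rule homI) (auto simp: code_loop_def T_mem T_add \<phi>'_def S_T)
    ultimately show ?thesis
      by (simp add: iso_def code_loop_def)
  qed
  then have "code_loop (F2.span {a, b, c}) \<phi> \<cong> code_loop (F2.span {a', b', c'}) \<phi>'"
    by (auto simp: is_iso_def)
  with coc' show thesis
    by (rule that)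
qed

section \<open>Representations and characteristic vectors\<close>

text \<open>For fixed \<open>w\<close> the parity of |u \<inter> w| is additive in \<open>u\<close>.
  Finiteness is carried through the induction because \<open>wt_add_times\<close> requires
  it.\<close>

lemma even_wt_times_span:
  assumes "u \<in> F2.span B" "\<And>g. g \<in> B \<Longrightarrow> finite (supp g) \<and> even (wt (g * w))"
  shows "even (wt (u * w))"
proof -
  have "finite (supp u) \<and> even (wt (u * w))"
    using assms(1)
  proof (induction rule: F2.span_induct_alt)
    case (step s g u)
    note g = assms(2)[OF step(1)] and u = step(2)
    have "even (wt ((g + u) * w) + 2 * wt (g * u * w))"
      unfolding wt_add_times[OF conjunct1[OF g] conjunct1[OF u]] using g u by (meson dvd_add)
    then have "finite (supp (g + u)) \<and> even (wt ((g + u) * w))"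
      using g u by (simp add: supp_add)
    then have "finite (supp (f2_scale s g + u)) \<and> even (wt ((f2_scale s g + u) * w))"
      using u by (cases s) (simp_all only: f2_scale_simps add_0_left)
    then show ?case .
  qed (auto simp flip: zero_fun_def)
  then show ?thesis ..
qed

text \<open>The parity of |u \<inter> v \<inter> w| is trilinear, and it vanishes on repeated
  arguments because pairwise intersections are even. Hence it is a multiple of its value on the
  basis: an associator -1 anywhere forces one at the generators.\<close>

lemma odd_wt_times_basis:
  assumes dec: "double_even_code m (F2.span {a, b, c})"
    and mem: "u \<in> F2.span {a, b, c}" "v \<in> F2.span {a, b, c}" "w \<in> F2.span {a, b, c}"
    and odd: "odd (wt (u * v * w))"
  shows "odd (wt (a * b * c))"
proof (rule ccontr)
  assume even: "\<not> odd (wt (a * b * c))"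
  have gen: "g \<in> F2.span {a, b, c}" "finite (supp g)" if "g \<in> {a, b, c}" for g
    using F2.span_base[OF that] double_even_codeD(2)[OF dec F2.span_base[OF that]] .
  have pair: "even (wt (g * h))" if "g \<in> {a, b, c}" "h \<in> {a, b, c}" for g h
  proof -
    have "card (supp g \<inter> supp h) mod 2 = 0"
      using dec gen(1)[OF that(1)] gen(1)[OF that(2)] by (simp add: double_even_code_def)
    then show ?thesis
      unfolding wt_def supp_times by presburger
  qed
  have "even (wt (e * (f * g)))" if "e \<in> {a, b, c}" "f \<in> {a, b, c}" "g \<in> {a, b, c}" for e f g
  proof -
    have "e * (e * f) = e * f" for e f :: f2vec
      by (simp flip: mult.assoc)
    then show ?thesis
      using that even pair pair[of a a] pair[of b b] pair[of c c] by (auto simp: ac_simps)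
  qed
  \<comment> \<open>The arguments are extended from generators to the span one at a time:
    \<open>w\<close>, then \<open>v\<close>, then \<open>u\<close>.\<close>
  then have "even (wt (e * (f * w)))" if "e \<in> {a, b, c}" "f \<in> {a, b, c}" for e f
    using even_wt_times_span[OF mem(3), of "e * f"] gen(2) that by (simp add: ac_simps)
  then have "even (wt (e * (v * w)))" if "e \<in> {a, b, c}" for e
    using even_wt_times_span[OF mem(2), of "e * w"] gen(2) that by (simp add: ac_simps)
  then have "even (wt (u * (v * w)))"
    using even_wt_times_span[OF mem(1), of "v * w"] gen(2) by blast
  then show False
    using odd by (simp add: mult.assoc)
qed

lemma minus_one_power_eq_bit_sign_iff: "(-1) ^ n = bit_sign x \<longleftrightarrow> n mod 2 = of_bit x"
  by (cases x) (auto simp: minus_one_power_iff odd_iff_mod_2_eq_one even_iff_mod_2_eq_zero)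

lemma mod_8_of_div_4: "n mod 4 = 0 \<Longrightarrow> n div 4 mod 2 = of_bit x \<Longrightarrow> n mod 8 = 4 * of_bit x" for n :: nat
  by (cases x; simp) presburger+

lemma mod_4_of_div_2: "n mod 2 = 0 \<Longrightarrow> n div 2 mod 2 = of_bit x \<Longrightarrow> n mod 4 = 2 * of_bit x" for n :: nat
  by (cases x; simp) presburger+

text \<open>Under \<open>h\<close> each square and commutator becomes a sign whose exponent is a
  weight or intersection size; with the associator of the generators these are the conditions of
  \<open>frame_iff\<close>.\<close>

lemma characteristic_vector_frame:
  assumes L: "is_loop L" and nonassoc: "nonassociative L" and char: "characteristic_vector L x y z ls"
  obtains m a b c \<phi> h where "cocycle_code m (F2.span {a, b, c}) \<phi>"
    "h \<in> iso L (code_loop (F2.span {a, b, c}) \<phi>)" "frame a b c ls"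
proof -
  from char obtain m V \<phi> h s where xyz: "x \<in> carrier L" "y \<in> carrier L" "z \<in> carrier L"
    and dec: "double_even_code m V" and coc: "code_cocycle V \<phi>"
    and h: "h \<in> iso L (code_loop V \<phi>)" and V: "F2.span {snd (h x), snd (h y), snd (h z)} = V"
    and s: "s \<in> carrier L" "h s = (-1, 0)"
    and ls: "[x \<otimes>\<^bsub>L\<^esub> x, y \<otimes>\<^bsub>L\<^esub> y, z \<otimes>\<^bsub>L\<^esub> z,
         loop_commutator L x y, loop_commutator L x z, loop_commutator L y z]
          = map (\<lambda>l. if l = 1 then s else \<one>\<^bsub>L\<^esub>) ls"
    unfolding characteristic_vector_def by (elim conjE exE) (rule that; assumption)
  interpret cocycle_code m V \<phi>
    using dec coc by unfold_locales
  define a b c where "a = snd (h x)" and "b = snd (h y)" and "c = snd (h z)"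
  have mem: "a \<in> V" "b \<in> V" "c \<in> V"
    using V by (auto simp: a_def b_def c_def intro: F2.span_base)
  have fin: "finite (supp a)" "finite (supp b)" "finite (supp c)"
    using mem double_even_codeD(2)[OF dec] by blast+
  have h_sign: "h (if l = 1 then s else \<one>\<^bsub>L\<^esub>) = (bit_sign l, 0)" for l
    using s iso_loop_one[OF L is_loop_CL h] by (cases l) auto
  have "length ls = 6"
    using arg_cong[OF ls, of length] by simp
  then obtain l1 l2 l3 l4 l5 l6 where ls': "ls = [l1, l2, l3, l4, l5, l6]"
    by (auto simp: numeral_eq_Suc length_Suc_conv)
  have h_square: "h (g \<otimes>\<^bsub>L\<^esub> g) = ((-1) ^ (wt (snd (h g)) div 4), 0)" if "g \<in> carrier L" for g
    using square_CL[of "snd (h g)" "fst (h g)"] isoD(1,2)[OF h] that carrier_CL[of "fst (h g)" "snd (h g)"]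
    by simp
  have square: "wt (snd (h g)) mod 8 = 4 * of_bit l"
    if "g \<in> carrier L" "g \<otimes>\<^bsub>L\<^esub> g = (if l = 1 then s else \<one>\<^bsub>L\<^esub>)" for g l
  proof (rule mod_8_of_div_4)
    have "h g \<in> carrier CL"
      using isoD(1)[OF h] that by blast
    then show "wt (snd (h g)) mod 4 = 0"
      using double_even_codeD(3)[OF dec] carrier_CL[of "fst (h g)" "snd (h g)"] by simp
    have "(-1) ^ (wt (snd (h g)) div 4) = bit_sign l"
      using h_square[OF that(1)] unfolding that(2) h_sign by simp
    then show "wt (snd (h g)) div 4 mod 2 = of_bit l"
      by (simp only: minus_one_power_eq_bit_sign_iff)
  qed
  have commutator: "wt (snd (h g) * snd (h k)) mod 4 = 2 * of_bit l"
    if "g \<in> carrier L" "k \<in> carrier L" "loop_commutator L g k = (if l = 1 then s else \<one>\<^bsub>L\<^esub>)" for g k l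
  proof (rule mod_4_of_div_2)
    have "h g \<in> carrier CL" "h k \<in> carrier CL"
      using isoD(1)[OF h] that by blast+
    then have "snd (h g) \<in> V" "snd (h k) \<in> V"
      using carrier_CL[of "fst (h g)" "snd (h g)"] carrier_CL[of "fst (h k)" "snd (h k)"] by simp_all
    then show "wt (snd (h g) * snd (h k)) mod 2 = 0"
      using dec unfolding double_even_code_def wt_def supp_times by blast
    have "(-1) ^ (wt (snd (h g) * snd (h k)) div 2) = bit_sign l"
      using iso_commutator(2)[OF L h that(1,2)] unfolding that(3) h_sign by simp
    then show "wt (snd (h g) * snd (h k)) div 2 mod 2 = of_bit l"
      by (simp only: minus_one_power_eq_bit_sign_iff)
  qed
  have "nonassociative CL"
    using iso_nonassociative[OF L h] nonassoc by blast
  then have "odd (wt (a * b * c))"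
    using nonassociative_CL odd_wt_times_basis[of m a b c] dec V unfolding a_def b_def c_def by blast
  moreover have "wt a mod 8 = 4 * of_bit (ls!0)" "wt b mod 8 = 4 * of_bit (ls!1)"
    "wt c mod 8 = 4 * of_bit (ls!2)" "wt (a * b) mod 4 = 2 * of_bit (ls!3)"
    "wt (a * c) mod 4 = 2 * of_bit (ls!4)" "wt (b * c) mod 4 = 2 * of_bit (ls!5)"
    using ls xyz unfolding a_def b_def c_def
    by (intro square commutator; simp add: ls')+
  ultimately have "frame a b c ls"
    using frame_iff[OF fin] by blast
  then show thesis
    using that[of m a b c \<phi> h] dec coc h V by (simp add: a_def b_def c_def cocycle_code.intro)
qed

lemma frame_rank3_loop:
  assumes F: "frame a b c ls" and len: "length ls = 6"
    and supp: "supp a \<subseteq> {1..m}" "supp b \<subseteq> {1..m}" "supp c \<subseteq> {1..m}"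
    and coc: "code_cocycle (F2.span {a, b, c}) \<phi>"
  shows "rank3_loop_with_vector ls (code_loop (F2.span {a, b, c}) \<phi>)"
proof -
  have dec: "double_even_code m (F2.span {a, b, c})"
    using frame_double_even_code F supp by blast
  interpret cocycle_code m "F2.span {a, b, c}" \<phi>
    using dec coc by unfold_locales
  have fin: "finite (supp a)" "finite (supp b)" "finite (supp c)"
    using F by (auto simp: frame_def)
  note wts = F[unfolded frame_iff[OF fin]]
  have mem: "a \<in> F2.span {a, b, c}" "b \<in> F2.span {a, b, c}" "c \<in> F2.span {a, b, c}"
    by (auto intro: F2.span_base)
  have id: "(\<lambda>x. x) \<in> iso CL CL"
    using bij_betw_id[of "carrier CL"] by (auto simp: iso_def hom_def id_def)
  note ind = frame_independent[OF F]
  have "F2.dim (F2.span {a, b, c}) = card {a, b, c}"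
    using ind(2) by (rule F2.dim_span_eq_card_independent)
  then have "F2.dim (F2.span {a, b, c}) = 3"
    using ind(1) by simp
  then have "is_code_loop_of_rank 3 CL"
    unfolding is_code_loop_of_rank_def isomorphic_to_code_loop_def is_iso_def
    using is_loop_CL dec coc id by blast
  moreover have "nonassociative CL"
    using nonassociative_CL mem wts by blast
  moreover have "characteristic_vector CL (1, a) (1, b) (1, c) ls"
  proof -
    obtain l1 l2 l3 l4 l5 l6 where ls: "ls = [l1, l2, l3, l4, l5, l6]"
      using len by (auto simp: numeral_eq_Suc length_Suc_conv)
    have sign: "(if l = 1 then (-1, 0) else \<one>\<^bsub>CL\<^esub>) = (bit_sign l, 0)" for l
      by (cases l) auto
    have carrier: "(1, a) \<in> carrier CL" "(1, b) \<in> carrier CL" "(1, c) \<in> carrier CL" "(-1, 0) \<in> carrier CL"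
      using mem by (simp_all add: carrier_CL F2.span_zero)
    have "(-1::int) ^ (wt a div 4) = bit_sign l1" "(-1::int) ^ (wt b div 4) = bit_sign l2"
      "(-1::int) ^ (wt c div 4) = bit_sign l3" "(-1::int) ^ (wt (a * b) div 2) = bit_sign l4"
      "(-1::int) ^ (wt (a * c) div 2) = bit_sign l5" "(-1::int) ^ (wt (b * c) div 2) = bit_sign l6"
      using wts by (auto simp: ls intro: minus_one_power_div_4 minus_one_power_div_2)
    then have eqs: "[(1, a) \<otimes>\<^bsub>CL\<^esub> (1, a), (1, b) \<otimes>\<^bsub>CL\<^esub> (1, b), (1, c) \<otimes>\<^bsub>CL\<^esub> (1, c),
        loop_commutator CL (1, a) (1, b), loop_commutator CL (1, a) (1, c), loop_commutator CL (1, b) (1, c)]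
          = map (\<lambda>l. if l = 1 then (-1, 0) else \<one>\<^bsub>CL\<^esub>) ls"
      using commutator_CL[OF carrier(1,2)] commutator_CL[OF carrier(1,3)] commutator_CL[OF carrier(2,3)]
        square_CL[OF mem(1), of 1] square_CL[OF mem(2), of 1] square_CL[OF mem(3), of 1]
      unfolding sign by (simp add: ls del: mult_CL)
    then show ?thesis
      unfolding characteristic_vector_def
    proof (intro conjI exI)
      show "(\<lambda>x. x) \<in> iso CL (code_loop (F2.span {a, b, c}) \<phi>)"
        by (rule id)
    qed (use carrier dec coc ind eqs in \<open>simp_all only: snd_conv simp_thms\<close>)
  qed
  ultimately show ?thesis
    unfolding rank3_loop_with_vector_def by blast
qed

lemma isomorphic_trans:
  "L \<cong> M \<Longrightarrow> M \<cong> N \<Longrightarrow> L \<cong> N"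
  by (auto simp: is_iso_def dest: iso_set_trans)

text \<open>Reduces the claim for each loop to finite checks on one frame and a numerical bound on
  the length of all frames with the same vector. The existence part keeps the universal part from
  being vacuous.\<close>

lemma frame_basic_representation:
  assumes F: "frame a b c ls" and len: "length ls = 6"
    and supp: "supp a \<subseteq> {1..m}" "supp b \<subseteq> {1..m}" "supp c \<subseteq> {1..m}"
    and red: "reduced m (F2.span {a, b, c})"
    and bound: "\<And>m' a' b' c'. frame a' b' c' ls \<Longrightarrow> supp a' \<subseteq> {1..m'} \<Longrightarrow> supp b' \<subseteq> {1..m'} \<Longrightarrow>
      supp c' \<subseteq> {1..m'} \<Longrightarrow> m \<le> m'"
  shows "(\<exists>C :: (int \<times> f2vec) monoid. rank3_loop_with_vector ls C) \<and>
    (\<forall>L :: 'a monoid. rank3_loop_with_vector ls L \<longrightarrow> basic_representation m (F2.span {a, b, c}) L)"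
proof (intro conjI allI impI)
  show "\<exists>C :: (int \<times> f2vec) monoid. rank3_loop_with_vector ls C"
    using frame_cocycle[OF F] frame_rank3_loop[OF F len supp] by metis
next
  fix L :: "'a monoid"
  assume rank3: "rank3_loop_with_vector ls L"
  then have L: "is_loop L" and nonassoc: "nonassociative L"
    by (auto simp: rank3_loop_with_vector_def is_code_loop_of_rank_def)
  \<comment> \<open>The code that comes with the characteristic vector of \<open>L\<close> is a
    bridge: it shares the form with \<open>a\<close>, \<open>b\<close>, \<open>c\<close>, and it is
    mapped into any competing code.\<close>
  obtain n u v w \<phi> h where coc: "cocycle_code n (F2.span {u, v, w}) \<phi>"
    and h: "h \<in> iso L (code_loop (F2.span {u, v, w}) \<phi>)" and G: "frame u v w ls"
    using rank3 characteristic_vector_frame[OF L nonassoc] unfolding rank3_loop_with_vector_def by metis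
  show "basic_representation m (F2.span {a, b, c}) L"
    unfolding basic_representation_def
  proof (intro conjI allI impI)
    obtain \<phi>' where "code_cocycle (F2.span {a, b, c}) \<phi>'"
      "code_loop (F2.span {u, v, w}) \<phi> \<cong> code_loop (F2.span {a, b, c}) \<phi>'"
      using frame_code_loop_iso[OF G F cocycle_code.cocycle[OF coc]] .
    then have "isomorphic_to_code_loop L (F2.span {a, b, c})"
      unfolding isomorphic_to_code_loop_def using h isomorphic_trans unfolding is_iso_def by blast
    then show "is_representation m (F2.span {a, b, c}) L"
      unfolding is_representation_def using red frame_double_even_code[OF F supp] by blast
  next
    fix m' V' assume "is_representation m' V' L"
    then obtain \<phi>' g where dec': "double_even_code m' V'" and coc': "cocycle_code m' V' \<phi>'"
      and g: "g \<in> iso L (code_loop V' \<phi>')"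
      unfolding is_representation_def isomorphic_to_code_loop_def is_iso_def
      by (auto intro: cocycle_code.intro)
    obtain k where "k \<in> iso (code_loop (F2.span {u, v, w}) \<phi>) L"
      using iso_loop_inverse[OF L h] .
    then obtain k' where k': "k' \<in> iso (code_loop (F2.span {u, v, w}) \<phi>) (code_loop V' \<phi>')"
      using g iso_set_trans by blast
    have "nonassociative (code_loop (F2.span {u, v, w}) \<phi>)"
      using iso_nonassociative[OF L h] nonassoc by blast
    from iso_code_loops_additive_map[OF coc coc' this k'] obtain T
      where T: "\<And>x. x \<in> F2.span {u, v, w} \<Longrightarrow> T x \<in> V'"
        "\<And>x y. x \<in> F2.span {u, v, w} \<Longrightarrow> y \<in> F2.span {u, v, w} \<Longrightarrow> T (x + y) = T x + T y"
        "\<And>x. x \<in> F2.span {u, v, w} \<Longrightarrow> wt (T x) mod 8 = wt x mod 8"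
      by blast
    have "T u \<in> V'" "T v \<in> V'" "T w \<in> V'"
      by (auto intro: T(1) F2.span_base)
    note supp' = this[THEN double_even_codeD(1)[OF dec']] this[THEN double_even_codeD(2)[OF dec']]
    show "m \<le> m'"
      by (rule bound[OF frame_transport[OF G T(2,3)]]) (use supp' in auto)
  qed
qed

section \<open>Lower bounds for the length\<close>

lemma supp_indicator [simp]: "supp (indicator A) = A"
  by (auto simp: supp_def indicator_def)

lemma indicator_times: "(indicator A :: f2vec) * indicator B = indicator (A \<inter> B)"
  by (auto simp: fun_eq_iff indicator_def)

lemma indicator_add: "(indicator A :: f2vec) + indicator B = indicator ((A - B) \<union> (B - A))"
  by (auto simp: fun_eq_iff indicator_def)

lemma frame_indicator_iff:
  assumes "finite A" "finite B" "finite C"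
  shows "frame (indicator A) (indicator B) (indicator C) ls \<longleftrightarrow>
    card A mod 8 = 4 * of_bit (ls!0) \<and> card B mod 8 = 4 * of_bit (ls!1) \<and>
    card C mod 8 = 4 * of_bit (ls!2) \<and> card (A \<inter> B) mod 4 = 2 * of_bit (ls!3) \<and>
    card (A \<inter> C) mod 4 = 2 * of_bit (ls!4) \<and> card (B \<inter> C) mod 4 = 2 * of_bit (ls!5) \<and>
    odd (card (A \<inter> B \<inter> C))"
  using assms by (simp add: frame_iff wt_def indicator_times)

text \<open>The generators are themselves codewords, so equivalent coordinates lie in the same
  region of their Venn diagram, the outer one included.\<close>

lemma reduced_span_indicator:
  assumes "\<And>p q r. card {j \<in> {1..m}. (j \<in> A) = p \<and> (j \<in> B) = q \<and> (j \<in> C) = r} < 8"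
  shows "reduced m (F2.span {indicator A, indicator B, indicator C})"
  unfolding reduced_def
proof
  fix X assume "X \<in> {1..m} // coord_equiv m (F2.span {indicator A, indicator B, indicator C})"
  then obtain i where X: "X = coord_equiv m (F2.span {indicator A, indicator B, indicator C}) `` {i}"
    by (auto simp: quotient_def)
  have "X \<subseteq> {j \<in> {1..m}. (j \<in> A) = (i \<in> A) \<and> (j \<in> B) = (i \<in> B) \<and> (j \<in> C) = (i \<in> C)}"
  proof
    fix j assume "j \<in> X"
    then have j: "j \<in> {1..m}" and v: "\<And>v. v \<in> F2.span {indicator A, indicator B, indicator C} \<Longrightarrow>
        {i, j} \<subseteq> supp v \<or> {i, j} \<inter> supp v = {}"
      by (auto simp: X coord_equiv_def)
    have "(j \<in> S) = (i \<in> S)" if "S \<in> {A, B, C}" for S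
      using v[OF F2.span_base, of "indicator S"] that by auto
    then show "j \<in> {j \<in> {1..m}. (j \<in> A) = (i \<in> A) \<and> (j \<in> B) = (i \<in> B) \<and> (j \<in> C) = (i \<in> C)}"
      using j by auto
  qed
  then have "card X \<le> card {j \<in> {1..m}. (j \<in> A) = (i \<in> A) \<and> (j \<in> B) = (i \<in> B) \<and> (j \<in> C) = (i \<in> C)}"
    by (intro card_mono) auto
  also have "\<dots> < 8"
    by (rule assms)
  finally show "card X < 8" .
qed

text \<open>The index of \<open>n\<close> names the supports that contain the region, all others
  being excluded. Coordinates outside the three supports account for the inequality.\<close>

lemma frame_regions:
  assumes F: "frame a b c ls"
    and supp: "supp a \<subseteq> {1..m}" "supp b \<subseteq> {1..m}" "supp c \<subseteq> {1..m}"
  obtains n1 n2 n3 n12 n13 n23 n123 :: nat where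
    "n1 + n2 + n3 + n12 + n13 + n23 + n123 \<le> m"
    "(n1 + n12 + n13 + n123) mod 8 = 4 * of_bit (cubic ls 1 0 0)"
    "(n2 + n12 + n23 + n123) mod 8 = 4 * of_bit (cubic ls 0 1 0)"
    "(n3 + n13 + n23 + n123) mod 8 = 4 * of_bit (cubic ls 0 0 1)"
    "(n1 + n2 + n13 + n23) mod 8 = 4 * of_bit (cubic ls 1 1 0)"
    "(n1 + n3 + n12 + n23) mod 8 = 4 * of_bit (cubic ls 1 0 1)"
    "(n2 + n3 + n12 + n13) mod 8 = 4 * of_bit (cubic ls 0 1 1)"
    "(n1 + n2 + n3 + n123) mod 8 = 4 * of_bit (cubic ls 1 1 1)"
proof -
  define A B C where "A = supp a" and "B = supp b" and "C = supp c"
  have fin: "finite A" "finite B" "finite C"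
    using F by (auto simp: frame_def A_def B_def C_def)
  define n1 n2 n3 n12 n13 n23 n123 where
    "n1 = card (A - B - C)" and "n2 = card (B - A - C)" and "n3 = card (C - A - B)" and
    "n12 = card (A \<inter> B - C)" and "n13 = card (A \<inter> C - B)" and "n23 = card (B \<inter> C - A)" and
    "n123 = card (A \<inter> B \<inter> C)"
  note n_defs = this
  have split: "card X = card (X \<inter> Y) + card (X - Y)" if "finite X" for X Y :: "nat set"
    using card_Int_Diff[OF that] .
  have ab: "card (A \<inter> B) = n12 + n123" and ac: "card (A \<inter> C) = n13 + n123"
    and bc: "card (B \<inter> C) = n23 + n123"
    using split[of "A \<inter> B" C] split[of "A \<inter> C" B] split[of "B \<inter> C" A] fin
    by (simp_all add: n_defs ac_simps)
  have sets: "(A - B) \<inter> C = A \<inter> C - B" "(B - A) \<inter> C = B \<inter> C - A" "(C - A) \<inter> B = B \<inter> C - A"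
    by auto
  have diff: "card (A - B) = n1 + n13" "card (B - A) = n2 + n23" "card (C - A) = n3 + n23"
    using split[of "A - B" C] split[of "B - A" C] split[of "C - A" B] fin
    by (simp_all add: n_defs sets)
  have cards: "card A = n1 + n12 + n13 + n123" "card B = n2 + n12 + n23 + n123"
    "card C = n3 + n13 + n23 + n123"
    using split[of A B] split[of B A] split[of C A] fin ab ac diff by (simp_all add: Int_commute)
  have "card (A \<union> (B - A)) = card A + card (B - A)"
    "card ((A \<union> B) \<union> (C - A - B)) = card (A \<union> B) + card (C - A - B)"
    by (rule card_Un_disjoint; use fin in auto)+
  moreover have "A \<union> (B - A) = A \<union> B" "(A \<union> B) \<union> (C - A - B) = A \<union> B \<union> C"
    by auto
  moreover have "card (A \<union> B \<union> C) \<le> card {1..m}"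
    using supp by (intro card_mono) (auto simp: A_def B_def C_def)
  ultimately have total: "n1 + n2 + n3 + n12 + n13 + n23 + n123 \<le> m"
    using cards diff n3_def by simp
  have wts: "wt a = card A" "wt b = card B" "wt c = card C" "wt (a * b) = card (A \<inter> B)"
    "wt (a * c) = card (A \<inter> C)" "wt (b * c) = card (B \<inter> C)" "wt (a * b * c) = n123"
    by (simp_all add: wt_def supp_times A_def B_def C_def n_defs)
  have fin': "finite (supp a)" "finite (supp b)" "finite (supp c)" "finite (supp (a + b))"
    using fin by (auto simp: A_def B_def C_def supp_add)
  moreover have "wt (a + b) = n1 + n2 + n13 + n23" "wt (a + c) = n1 + n3 + n12 + n23"
    "wt (b + c) = n2 + n3 + n12 + n13"
    using wt_add[OF fin'(1,2)] wt_add[OF fin'(1,3)] wt_add[OF fin'(2,3)] wts cards ab ac bc by linarith+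
  moreover from this have "wt (a + b + c) = n1 + n2 + n3 + n123"
    using wt_add[OF fin'(4,3)] wt_add_times[OF fin'(1,2), of c] wts cards ab ac bc by linarith
  ultimately have sums: "wt (comb a b c 1 0 0) = n1 + n12 + n13 + n123"
    "wt (comb a b c 0 1 0) = n2 + n12 + n23 + n123" "wt (comb a b c 0 0 1) = n3 + n13 + n23 + n123"
    "wt (comb a b c 1 1 0) = n1 + n2 + n13 + n23" "wt (comb a b c 1 0 1) = n1 + n3 + n12 + n23"
    "wt (comb a b c 0 1 1) = n2 + n3 + n12 + n13" "wt (comb a b c 1 1 1) = n1 + n2 + n3 + n123"
    using cards wts by (simp_all only: comb_def f2_scale_simps add_0_left add_0_right)
  show thesis
    using that[of n1 n2 n3 n12 n13 n23 n123] total unfolding sums[symmetric] frame_wt[OF F] by simp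
qed

text \<open>Each region lies in four of the seven nonzero codewords, and two distinct regions lie
  together in exactly two. Adding the weights of the four codewords through a region and subtracting
  the other three therefore leaves 4 times its size. Modulo 8 the signs are immaterial, so the size
  has the parity of the sum of all seven bits.\<close>

lemma odd_region:
  fixes n :: nat
  assumes eq: "4 * n + w5 + w6 + w7 = w1 + w2 + w3 + w4"
    and w: "w1 mod 8 = 4 * of_bit x1" "w2 mod 8 = 4 * of_bit x2" "w3 mod 8 = 4 * of_bit x3"
      "w4 mod 8 = 4 * of_bit x4" "w5 mod 8 = 4 * of_bit x5" "w6 mod 8 = 4 * of_bit x6"
      "w7 mod 8 = 4 * of_bit x7"
    and x: "x1 + x2 + x3 + x4 + x5 + x6 + x7 = 1"
  shows "odd n"
proof -
  have "\<exists>k. v = 8 * k + 4 * of_bit y" if "v mod 8 = 4 * of_bit y" for v :: nat and y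
    using that by (metis mult_div_mod_eq)
  from w[THEN this] obtain k1 k2 k3 k4 k5 k6 k7 where
    k: "w1 = 8 * k1 + 4 * of_bit x1" "w2 = 8 * k2 + 4 * of_bit x2" "w3 = 8 * k3 + 4 * of_bit x3"
    "w4 = 8 * k4 + 4 * of_bit x4" "w5 = 8 * k5 + 4 * of_bit x5" "w6 = 8 * k6 + 4 * of_bit x6"
    "w7 = 8 * k7 + 4 * of_bit x7"
    by blast
  have "n + 2 * (k5 + k6 + k7) + b5 + b6 + b7 = 2 * (k1 + k2 + k3 + k4) + b1 + b2 + b3 + b4"
    if "4 * n + (8 * k5 + 4 * b5) + (8 * k6 + 4 * b6) + (8 * k7 + 4 * b7) =
      (8 * k1 + 4 * b1) + (8 * k2 + 4 * b2) + (8 * k3 + 4 * b3) + (8 * k4 + 4 * b4)"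
    for b1 b2 b3 b4 b5 b6 b7 :: nat
  proof -
    have "4 * (n + 2 * (k5 + k6 + k7) + b5 + b6 + b7) = 4 * (2 * (k1 + k2 + k3 + k4) + b1 + b2 + b3 + b4)"
      using that by (simp add: algebra_simps)
    then show ?thesis
      by simp
  qed
  from this[OF eq[unfolded k]]
  have "even n \<longleftrightarrow> even (of_bit x1 + of_bit x2 + of_bit x3 + of_bit x4 + of_bit x5 + of_bit x6 + of_bit x7 :: nat)"
    by (smt (verit) even_add even_mult_iff even_numeral)
  moreover have "odd (x1 + x2 + x3 + x4 + x5 + x6 + x7)"
    using x by simp
  moreover have "even (of_bit y :: nat) \<longleftrightarrow> even y" for y
    by (cases y) simp_all
  ultimately show ?thesis
    by (simp only: even_add) blast
qed

text \<open>
  All seven regions of the Venn diagram have odd size, because the values of the cubic form sum up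
  to 1. Writing the sizes as \<open>2 t + 1\<close> leaves one congruence modulo 4 for each nonzero codeword.
\<close>

lemma frame_half_regions:
  assumes F: "frame a b c ls"
    and supp: "supp a \<subseteq> {1..m}" "supp b \<subseteq> {1..m}" "supp c \<subseteq> {1..m}"
  obtains t1 t2 t3 t12 t13 t23 t123 :: nat where
    "7 + 2 * (t1 + t2 + t3 + t12 + t13 + t23 + t123) \<le> m"
    "(t1 + t12 + t13 + t123) mod 4 = 2 * of_bit (cubic ls 1 0 0 + 1)"
    "(t2 + t12 + t23 + t123) mod 4 = 2 * of_bit (cubic ls 0 1 0 + 1)"
    "(t3 + t13 + t23 + t123) mod 4 = 2 * of_bit (cubic ls 0 0 1 + 1)"
    "(t1 + t2 + t13 + t23) mod 4 = 2 * of_bit (cubic ls 1 1 0 + 1)"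
    "(t1 + t3 + t12 + t23) mod 4 = 2 * of_bit (cubic ls 1 0 1 + 1)"
    "(t2 + t3 + t12 + t13) mod 4 = 2 * of_bit (cubic ls 0 1 1 + 1)"
    "(t1 + t2 + t3 + t123) mod 4 = 2 * of_bit (cubic ls 1 1 1 + 1)"
proof -
  obtain n1 n2 n3 n12 n13 n23 n123 where
    m: "n1 + n2 + n3 + n12 + n13 + n23 + n123 \<le> m" and
    w: "(n1 + n12 + n13 + n123) mod 8 = 4 * of_bit (cubic ls 1 0 0)"
      "(n2 + n12 + n23 + n123) mod 8 = 4 * of_bit (cubic ls 0 1 0)"
      "(n3 + n13 + n23 + n123) mod 8 = 4 * of_bit (cubic ls 0 0 1)"
      "(n1 + n2 + n13 + n23) mod 8 = 4 * of_bit (cubic ls 1 1 0)"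
      "(n1 + n3 + n12 + n23) mod 8 = 4 * of_bit (cubic ls 1 0 1)"
      "(n2 + n3 + n12 + n13) mod 8 = 4 * of_bit (cubic ls 0 1 1)"
      "(n1 + n2 + n3 + n123) mod 8 = 4 * of_bit (cubic ls 1 1 1)"
    using frame_regions[OF F supp] .
  have "cubic ls 0 0 0 = 0"
    by (simp add: cubic_def)
  then have sum: "cubic ls 0 0 1 + cubic ls 0 1 0 + cubic ls 0 1 1 +
      cubic ls 1 0 0 + cubic ls 1 0 1 + cubic ls 1 1 0 + cubic ls 1 1 1 = 1"
    using sum_cubic[of ls] by simp
  \<comment> \<open>In each index list the four codewords containing the region come first, then the
    other three.\<close>
  have "odd n1" "odd n2" "odd n3" "odd n12" "odd n13" "odd n23" "odd n123"
    by (rule odd_region[OF _ w(1,4,5,7,2,3,6)] odd_region[OF _ w(2,4,6,7,1,3,5)]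
      odd_region[OF _ w(3,5,6,7,1,2,4)] odd_region[OF _ w(1,2,5,6,3,4,7)]
      odd_region[OF _ w(1,3,4,6,2,5,7)] odd_region[OF _ w(2,3,4,5,1,6,7)]
      odd_region[OF _ w(1,2,3,7,4,5,6)]; use sum in \<open>simp add: ac_simps\<close>; fail)+
  then obtain t1 t2 t3 t12 t13 t23 t123 where n: "n1 = 2 * t1 + 1" "n2 = 2 * t2 + 1" "n3 = 2 * t3 + 1"
    "n12 = 2 * t12 + 1" "n13 = 2 * t13 + 1" "n23 = 2 * t23 + 1" "n123 = 2 * t123 + 1"
    by (auto elim!: oddE)
  \<comment> \<open>Every codeword consists of four regions, each contributing one odd unit; this is
    the 4 in \<open>2 * s + 4\<close>, and it shifts the bit by 1.\<close>
  have half: "s mod 4 = 2 * of_bit (x + 1)" if "v mod 8 = 4 * of_bit x" "v = 2 * s + 4" for s v :: nat and x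
    using that by (cases x; simp) presburger+
  show thesis
    by (rule that[OF _ w[THEN half]]) (use m n in simp_all)
qed

lemma mod_4_cases:
  fixes s :: nat
  shows "s \<le> 4 \<Longrightarrow> s mod 4 = 0 \<Longrightarrow> s = 0 \<or> s = 4" "s \<le> 4 \<Longrightarrow> s mod 4 = 2 \<Longrightarrow> s = 2"
  by presburger+

lemma frame_length_ge_7:
  assumes "frame a b c ls" "supp a \<subseteq> {1..m}" "supp b \<subseteq> {1..m}" "supp c \<subseteq> {1..m}"
  shows "7 \<le> m"
  using frame_half_regions[OF assms] by (meson add_leD1)

text \<open>The total of the \<open>t\<close> is at most 4 below length 17, at most 2 below 13 and
  at most 1 below 11, since 7 + 2 * 5 = 17, 7 + 2 * 3 = 13 and 7 + 2 * 2 = 11. The congruences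
  modulo 4 then turn into exact values: 2, or one of 0 and 4.\<close>

lemma frame_length_bound:
  assumes F: "frame a b c ls" and supp: "supp a \<subseteq> {1..m}" "supp b \<subseteq> {1..m}" "supp c \<subseteq> {1..m}"
  shows "ls = [0, 0, 0, 0, 0, 0] \<Longrightarrow> 13 \<le> m" "ls = [0, 0, 0, 1, 1, 1] \<Longrightarrow> 11 \<le> m"
    "ls = [1, 1, 0, 0, 0, 0] \<Longrightarrow> 17 \<le> m" "ls = [1, 0, 0, 0, 0, 0] \<Longrightarrow> 17 \<le> m"
proof -
  obtain t1 t2 t3 t12 t13 t23 t123 where
    m: "7 + 2 * (t1 + t2 + t3 + t12 + t13 + t23 + t123) \<le> m" and
    t: "(t1 + t12 + t13 + t123) mod 4 = 2 * of_bit (cubic ls 1 0 0 + 1)"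
      "(t2 + t12 + t23 + t123) mod 4 = 2 * of_bit (cubic ls 0 1 0 + 1)"
      "(t3 + t13 + t23 + t123) mod 4 = 2 * of_bit (cubic ls 0 0 1 + 1)"
      "(t1 + t2 + t13 + t23) mod 4 = 2 * of_bit (cubic ls 1 1 0 + 1)"
      "(t1 + t3 + t12 + t23) mod 4 = 2 * of_bit (cubic ls 1 0 1 + 1)"
      "(t2 + t3 + t12 + t13) mod 4 = 2 * of_bit (cubic ls 0 1 1 + 1)"
      "(t1 + t2 + t3 + t123) mod 4 = 2 * of_bit (cubic ls 1 1 1 + 1)"
    using frame_half_regions[OF F supp] .
  have small: "t1 + t12 + t13 + t123 \<le> 4" "t2 + t12 + t23 + t123 \<le> 4" "t3 + t13 + t23 + t123 \<le> 4"
    "t1 + t2 + t13 + t23 \<le> 4" "t1 + t3 + t12 + t23 \<le> 4" "t2 + t3 + t12 + t13 \<le> 4"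
    "t1 + t2 + t3 + t123 \<le> 4" "t1 + t2 + t3 + t12 + t13 + t23 + t123 \<le> 4" if "m < 17"
  proof -
    have "s \<le> 4" if "7 + 2 * s \<le> m" for s
      using that \<open>m < 17\<close> by presburger
    from this[OF m] show "t1 + t12 + t13 + t123 \<le> 4" "t2 + t12 + t23 + t123 \<le> 4" "t3 + t13 + t23 + t123 \<le> 4"
      "t1 + t2 + t13 + t23 \<le> 4" "t1 + t3 + t12 + t23 \<le> 4" "t2 + t3 + t12 + t13 \<le> 4"
      "t1 + t2 + t3 + t123 \<le> 4" "t1 + t2 + t3 + t12 + t13 + t23 + t123 \<le> 4"
      by linarith+
  qed
  have cases: "s = 2" if "s \<le> 4" "s mod 4 = 2 * of_bit x" "x = 1" for s :: nat and x
    using that mod_4_cases(2) by simp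
  have cases': "s = 0 \<or> s = 4" if "s \<le> 4" "s mod 4 = 2 * of_bit x" "x = 0" for s :: nat and x
    using that mod_4_cases(1) by simp
  show "13 \<le> m" if "ls = [0, 0, 0, 0, 0, 0]"
  proof (rule ccontr)
    assume "\<not> 13 \<le> m"
    moreover have "s \<le> 2" if "7 + 2 * s \<le> m" "m < 13" for s
      using that by presburger
    ultimately have "t1 + t2 + t3 + t12 + t13 + t23 + t123 \<le> 2" "m < 17"
      using m by simp_all
    \<comment> \<open>Six codewords carry 2 out of a total of at most 2, so any region with positive
      \<open>t\<close> would lie in all six, whereas it lies in only four.\<close>
    with cases[OF small(1) t(1)] cases[OF small(2) t(2)] cases[OF small(3) t(3)]
      cases[OF small(4) t(4)] cases[OF small(5) t(5)] cases[OF small(6) t(6)] show False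
      by (simp add: that cubic_def)
  qed
  show "11 \<le> m" if "ls = [0, 0, 0, 1, 1, 1]"
  proof (rule ccontr)
    assume "\<not> 11 \<le> m"
    moreover have "s \<le> 1" if "7 + 2 * s \<le> m" "m < 11" for s
      using that by presburger
    ultimately have "t1 + t2 + t3 + t12 + t13 + t23 + t123 \<le> 1" "m < 17"
      using m by simp_all
    with cases[OF small(1) t(1)] show False
      by (simp add: that cubic_def)
  qed
  show "17 \<le> m" if ls: "ls = [1, 1, 0, 0, 0, 0]"
  proof (rule ccontr)
    assume "\<not> 17 \<le> m"
    then have lt: "m < 17"
      by simp
    note small = small[OF lt]
    \<comment> \<open>The third generator and the sum of the first two are the nonzero codewords
      where the form vanishes. The other five sums are 0 or 4, and each choice is linearly
      inconsistent.\<close>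
    have two: "t3 + t13 + t23 + t123 = 2" "t1 + t2 + t13 + t23 = 2"
      by (rule cases[OF small(3) t(3)] cases[OF small(4) t(4)]; simp add: ls cubic_def)+
    have "t1 + t12 + t13 + t123 = 0 \<or> t1 + t12 + t13 + t123 = 4"
      "t2 + t12 + t23 + t123 = 0 \<or> t2 + t12 + t23 + t123 = 4"
      "t1 + t3 + t12 + t23 = 0 \<or> t1 + t3 + t12 + t23 = 4"
      "t2 + t3 + t12 + t13 = 0 \<or> t2 + t3 + t12 + t13 = 4"
      "t1 + t2 + t3 + t123 = 0 \<or> t1 + t2 + t3 + t123 = 4"
      by (rule cases'[OF small(1) t(1)] cases'[OF small(2) t(2)] cases'[OF small(5) t(5)]
        cases'[OF small(6) t(6)] cases'[OF small(7) t(7)]; simp add: ls cubic_def)+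
    with two small(8) show False
      by (elim disjE) linarith+
  qed
  show "17 \<le> m" if ls: "ls = [1, 0, 0, 0, 0, 0]"
  proof (rule ccontr)
    assume "\<not> 17 \<le> m"
    then have lt: "m < 17"
      by simp
    note small = small[OF lt]
    \<comment> \<open>If none of the other three sums is 4, the total is 2 and both \<open>b\<close>
      and \<open>c\<close> exhaust it, so the sum for \<open>b + c\<close> would be 0. Otherwise the
      total is 4, counting each region in four codewords makes exactly two sums equal to 4, and the
      sum of those two codewords, one of \<open>b\<close>, \<open>c\<close>, \<open>b + c\<close>,
      would get 0.\<close>
    have two: "t2 + t12 + t23 + t123 = 2" "t3 + t13 + t23 + t123 = 2" "t2 + t3 + t12 + t13 = 2"
       "t1 + t2 + t3 + t123 = 2"
      by (rule cases[OF small(2) t(2)] cases[OF small(3) t(3)] cases[OF small(6) t(6)]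
        cases[OF small(7) t(7)]; simp add: ls cubic_def)+
    have "t1 + t12 + t13 + t123 = 0 \<or> t1 + t12 + t13 + t123 = 4"
      "t1 + t2 + t13 + t23 = 0 \<or> t1 + t2 + t13 + t23 = 4"
      "t1 + t3 + t12 + t23 = 0 \<or> t1 + t3 + t12 + t23 = 4"
      by (rule cases'[OF small(1) t(1)] cases'[OF small(4) t(4)] cases'[OF small(5) t(5)];
        simp add: ls cubic_def)+
    with two small(8) show False
      by (elim disjE) linarith+
  qed
qed

section \<open>The five codes\<close>

text \<open>Filtering an explicit list makes the region sizes computable by simplification.\<close>

lemma reduced_span_indicator_code:
  assumes "\<And>p q r. length (filter (\<lambda>j. (j \<in> A) = p \<and> (j \<in> B) = q \<and> (j \<in> C) = r) [1..<Suc m]) < 8"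
  shows "reduced m (F2.span {indicator A, indicator B, indicator C})"
proof (rule reduced_span_indicator)
  fix p q r
  have eq: "{j \<in> {1..m}. (j \<in> A) = p \<and> (j \<in> B) = q \<and> (j \<in> C) = r} =
      set (filter (\<lambda>j. (j \<in> A) = p \<and> (j \<in> B) = q \<and> (j \<in> C) = r) [1..<Suc m])"
    by auto
  show "card {j \<in> {1..m}. (j \<in> A) = p \<and> (j \<in> B) = q \<and> (j \<in> C) = r} < 8"
    unfolding eq by (rule le_less_trans[OF card_length assms])
qed

lemma atLeastAtMost_1_8_12:
  "{1..8::nat} = {1,2,3,4,5,6,7,8}" "{1..12::nat} = {1,2,3,4,5,6,7,8,9,10,11,12}"
proof -
  have "{1..8::nat} = set [1..<9]" "{1..12::nat} = set [1..<13]"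
    by auto
  then show "{1..8::nat} = {1,2,3,4,5,6,7,8}" "{1..12::nat} = {1,2,3,4,5,6,7,8,9,10,11,12}"
    by (simp_all add: upt_rec numeral_eq_Suc)
qed

text \<open>All seven regions are single points: this is the simplex code, whose nonzero words all
  have weight 4, so the bound 7 is attained.\<close>

lemma V1_basic:
  "(\<exists>C :: (int \<times> f2vec) monoid. is_C1 C) \<and> (\<forall>L :: 'a monoid. is_C1 L \<longrightarrow> basic_representation 7 V1 L)"
  unfolding is_C1_def V1_def spanned_by_def list.set image_insert image_empty
proof (rule frame_basic_representation)
  show "frame (indicator {1,2,3,4}) (indicator {1,2,5,6}) (indicator {1,3,5,7}) [1, 1, 1, 1, 1, 1]"
    by (simp add: frame_indicator_iff)
  show "reduced 7 (F2.span {indicator {1,2,3,4}, indicator {1,2,5,6}, indicator {1,3,5,7}})"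
    by (rule reduced_span_indicator_code) (simp add: upt_rec)
qed ((rule frame_length_ge_7; assumption) | simp)+

lemma V2_basic:
  "(\<exists>C :: (int \<times> f2vec) monoid. is_C2 C) \<and> (\<forall>L :: 'a monoid. is_C2 L \<longrightarrow> basic_representation 13 V2 L)"
  unfolding is_C2_def V2_def spanned_by_def list.set image_insert image_empty atLeastAtMost_1_8_12
proof (rule frame_basic_representation)
  show "frame (indicator {1,2,3,4,5,6,7,8}) (indicator {1,2,3,4,9,10,11,12})
      (indicator {1,5,6,7,9,10,11,13}) [0, 0, 0, 0, 0, 0]"
    by (simp add: frame_indicator_iff)
  show "reduced 13 (F2.span {indicator {1,2,3,4,5,6,7,8}, indicator {1,2,3,4,9,10,11,12},
      indicator {1,5,6,7,9,10,11,13}})"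
    by (rule reduced_span_indicator_code) (simp add: upt_rec)
qed ((rule frame_length_bound(1)[OF _ _ _ _ refl]; assumption) | simp)+

lemma V3_basic:
  "(\<exists>C :: (int \<times> f2vec) monoid. is_C3 C) \<and> (\<forall>L :: 'a monoid. is_C3 L \<longrightarrow> basic_representation 11 V3 L)"
  unfolding is_C3_def V3_def spanned_by_def list.set image_insert image_empty atLeastAtMost_1_8_12
proof (rule frame_basic_representation)
  show "frame (indicator {1,2,3,4,5,6,7,8}) (indicator {1,2,3,4,5,6,9,10})
      (indicator {1,2,3,4,5,7,9,11}) [0, 0, 0, 1, 1, 1]"
    by (simp add: frame_indicator_iff)
  show "reduced 11 (F2.span {indicator {1,2,3,4,5,6,7,8}, indicator {1,2,3,4,5,6,9,10},
      indicator {1,2,3,4,5,7,9,11}})"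
    by (rule reduced_span_indicator_code) (simp add: upt_rec)
qed ((rule frame_length_bound(2)[OF _ _ _ _ refl]; assumption) | simp)+

lemma span_triple_change:
  "F2.span {a, b, c} = F2.span {b, a + c, b + (c :: f2vec)}"
  "F2.span {a, b, c} = F2.span {a, a + b, a + (c :: f2vec)}"
proof -
  have "comb b (a + c) (b + c) x y z = comb a b c y (x + z) (y + z)"
    "comb a (a + b) (a + c) x y z = comb a b c (x + y + z) y z" for x y z
    by (simp_all only: comb_def F2.scale_left_distrib F2.scale_right_distrib ac_simps)
  \<comment> \<open>The inverse coordinate changes, which give the opposite inclusions of the
    spans.\<close>
  moreover have "comb a b c x y z = comb b (a + c) (b + c) (x + y + z) x (x + z)"
    "comb a b c x y z = comb a (a + b) (a + c) (x + y + z) y z" for x y z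
    by (simp_all add: comb_def F2.scale_left_distrib F2.scale_right_distrib ac_simps)
  ultimately show "F2.span {a, b, c} = F2.span {b, a + c, b + (c :: f2vec)}"
    "F2.span {a, b, c} = F2.span {a, a + b, a + (c :: f2vec)}"
    unfolding span_triple by (intro Collect_cong; metis)+
qed

text \<open>
  The generators of \<open>V\<^sub>4\<close> and \<open>V\<^sub>5\<close> are not adapted to the characteristic vectors of \<open>C\<^sub>4\<close> and \<open>C\<^sub>5\<close>.
\<close>

lemma V4_eq: "V4 = F2.span {indicator {1,2,5,6,7,8,9,10,11,12,13,14},
    indicator {2,4,5,6,7,8,9,10,11,15,16,17}, indicator {2,3,12,13,14,15,16,17}}"
proof -
  have sets: "({1,2,3,4} - {1,3,5,6,7,8,9,10,11,15,16,17}) \<union> ({1,3,5,6,7,8,9,10,11,15,16,17} - {1,2,3,4}) =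
      {2,4,5,6,7,8,9,10,11,15,16,17::nat}"
    "({1,2,5,6,7,8,9,10,11,12,13,14} - {1,3,5,6,7,8,9,10,11,15,16,17}) \<union>
      ({1,3,5,6,7,8,9,10,11,15,16,17} - {1,2,5,6,7,8,9,10,11,12,13,14}) = {2,3,12,13,14,15,16,17::nat}"
    by (simp_all add: insert_Diff_if) (simp_all only: insert_commute)
  show ?thesis
    unfolding V4_def spanned_by_def list.set image_insert image_empty
    by (subst span_triple_change(1)) (simp only: indicator_add sets)
qed

lemma V5_eq: "V5 = F2.span {indicator {1,2,3,4,5,6,7,8,9,10,11,12},
    indicator {9,10,11,12,13,14,15,16}, indicator {6,7,8,12,13,14,15,17}}"
proof -
  have sets: "({1,2,3,4,5,6,7,8,9,10,11,12} - {1,2,3,4,5,6,7,8,13,14,15,16}) \<union>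
      ({1,2,3,4,5,6,7,8,13,14,15,16} - {1,2,3,4,5,6,7,8,9,10,11,12}) = {9,10,11,12,13,14,15,16::nat}"
    "({1,2,3,4,5,6,7,8,9,10,11,12} - {1,2,3,4,5,9,10,11,13,14,15,17}) \<union>
      ({1,2,3,4,5,9,10,11,13,14,15,17} - {1,2,3,4,5,6,7,8,9,10,11,12}) = {6,7,8,12,13,14,15,17::nat}"
    by (simp_all add: insert_Diff_if) (simp_all only: insert_commute)
  show ?thesis
    unfolding V5_def spanned_by_def list.set image_insert image_empty atLeastAtMost_1_8_12
    by (subst span_triple_change(2)) (simp only: indicator_add sets)
qed

lemma V4_basic:
  "(\<exists>C :: (int \<times> f2vec) monoid. is_C4 C) \<and> (\<forall>L :: 'a monoid. is_C4 L \<longrightarrow> basic_representation 17 V4 L)"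
  unfolding is_C4_def V4_eq
proof (rule frame_basic_representation)
  show "frame (indicator {1,2,5,6,7,8,9,10,11,12,13,14}) (indicator {2,4,5,6,7,8,9,10,11,15,16,17})
      (indicator {2,3,12,13,14,15,16,17}) [1, 1, 0, 0, 0, 0]"
    by (simp add: frame_indicator_iff)
  show "reduced 17 (F2.span {indicator {1,2,5,6,7,8,9,10,11,12,13,14},
      indicator {2,4,5,6,7,8,9,10,11,15,16,17}, indicator {2,3,12,13,14,15,16,17}})"
    by (rule reduced_span_indicator_code) (simp add: upt_rec)
qed ((rule frame_length_bound(3)[OF _ _ _ _ refl]; assumption) | simp)+

lemma V5_basic:
  "(\<exists>C :: (int \<times> f2vec) monoid. is_C5 C) \<and> (\<forall>L :: 'a monoid. is_C5 L \<longrightarrow> basic_representation 17 V5 L)"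
  unfolding is_C5_def V5_eq
proof (rule frame_basic_representation)
  show "frame (indicator {1,2,3,4,5,6,7,8,9,10,11,12}) (indicator {9,10,11,12,13,14,15,16})
      (indicator {6,7,8,12,13,14,15,17}) [1, 0, 0, 0, 0, 0]"
    by (simp add: frame_indicator_iff)
  show "reduced 17 (F2.span {indicator {1,2,3,4,5,6,7,8,9,10,11,12},
      indicator {9,10,11,12,13,14,15,16}, indicator {6,7,8,12,13,14,15,17}})"
    by (rule reduced_span_indicator_code) (simp add: upt_rec)
qed ((rule frame_length_bound(4)[OF _ _ _ _ refl]; assumption) | simp)+

theorem theorem5:
  shows
    "((\<exists>C :: (int \<times> f2vec) monoid. is_C1 C) \<and>
      (\<forall>L :: 'a monoid. is_C1 L \<longrightarrow> basic_representation 7 V1 L)) \<and>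
     ((\<exists>C :: (int \<times> f2vec) monoid. is_C2 C) \<and>
      (\<forall>L :: 'a monoid. is_C2 L \<longrightarrow> basic_representation 13 V2 L)) \<and>
     ((\<exists>C :: (int \<times> f2vec) monoid. is_C3 C) \<and>
      (\<forall>L :: 'a monoid. is_C3 L \<longrightarrow> basic_representation 11 V3 L)) \<and>
     ((\<exists>C :: (int \<times> f2vec) monoid. is_C4 C) \<and>
      (\<forall>L :: 'a monoid. is_C4 L \<longrightarrow> basic_representation 17 V4 L)) \<and>
     ((\<exists>C :: (int \<times> f2vec) monoid. is_C5 C) \<and>
      (\<forall>L :: 'a monoid. is_C5 L \<longrightarrow> basic_representation 17 V5 L))"
  by (intro conjI[OF V1_basic] conjI[OF V2_basic] conjI[OF V3_basic] conjI[OF V4_basic] V5_basic)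

end
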